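(* The following identities hold (the first and sixth for all $n\ge0$, the others for all $n\ge1$): $$B_n(A-1)-(A-1)B_{n+1}=2+\mathcal{H}_{n+1}J\mathcal{H}_{n+1}^{-1}-\mathcal{H}_nJ\mathcal{H}_n^{-1},$$ $$B_n=[B_n,J]+\mathcal{H}_n(A^t-1)\mathcal{H}_{n-1}^{-1}-\mathcal{H}_{n+1}(A^t-1)\mathcal{H}_n^{-1},$$ $$2\mathcal{H}_n\mathcal{H}_{n-1}^{-1}=[\mathcal{H}_n\mathcal{H}_{n-1}^{-1},J]-B_n\mathcal{H}_n(A^t-1)\mathcal{H}_{n-1}^{-1}-\mathcal{H}_n(A^t-1)\mathcal{H}_{n-1}^{-1}B_{n-1},$$ $$B_n=-[J,\mathcal{H}_nJ\mathcal{H}_n^{-1}]-\mathcal{H}_n(A^t-1)\mathcal{H}_{n-1}^{-1}(A-1)+(A-1)\mathcal{H}_{n+1}(A^t-1)\mathcal{H}_n^{-1},$$ $$\Gamma_nC_n-C_n\Gamma_{n-1}=\mathcal{H}_n(A-1)^*\mathcal{H}_{n-1}^{-1},$$ $$[\Gamma_n,\mathcal{H}_nJ\mathcal{H}_n^{-1}]=n+\Gamma_n+\mathcal{H}_nJ\mathcal{H}_n^{-1},$$ $$\Gamma_n\,\mathcal{H}_n(A-1)^*\mathcal{H}_{n-1}^{-1}-\mathcal{H}_n(A-1)^*\mathcal{H}_{n-1}^{-1}\,\Gamma_{n-1}=-\mathcal{H}_n(A-1)^*\mathcal{H}_{n-1}^{-1}.$$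
   Context: Let $N\ge1$, $\nu>0$, let $a_1,\dots,a_{N-1}$ be real, let $E_{i,j}$ be the matrix units, and put $J=\sum_{k=1}^NkE_{k,k}$, $A=\sum_{k=1}^{N-1}a_kE_{k+1,k}$. Let $\delta_1^{(\nu)},\dots,\delta_N^{(\nu)}>0$ and $$W^{(\nu)}(x)=e^{Ax}\,T^{(\nu)}(x)\,e^{A^*x},\qquad T^{(\nu)}(x)=e^{-x}\sum_{k=1}^N\delta_k^{(\nu)}x^{\nu+k}E_{k,k},\qquad x\in[0,\infty).$$ Let $(P(x,n))_{n\ge0}$ be the unique sequence of monic polynomials of degree $n$ in $M_N(\mathbb{C})[x]$ with $\int_0^\infty P(x,n)W^{(\nu)}(x)P(x,m)^*\,dx=\delta_{n,m}\mathcal{H}_n$. They satisfy $xP(x,n)=P(x,n+1)+B_nP(x,n)+C_nP(x,n-1)$, where $C_n=\mathcal{H}_n\mathcal{H}_{n-1}^{-1}$ and $P(x,-1)=0$. Put $\Gamma_n=A(n+\nu+1+J)-n-J$. Here $A^t=A^*$ since $A$ is real, $[\cdot,\cdot]$ is the matrix commutator, and scalars denote multiples of the identity matrix.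
   Formalization: In the third identity the last term is taken with a plus sign, + H_n(A^t−1)H_{n−1}^{-1}B_{n−1}; with the printed minus sign it fails for N=1, where it would read 2C_n = C_n(4n+2ν+2). *)

theory Defs
  imports "HOL-Analysis.Analysis" "Jordan_Normal_Form.Schur_Decomposition"
begin

text \<open>
  Elements of \<open>M\<^sub>N(\<complex>)\<close> are \<open>N \<times> N\<close> matrices of type \<^typ>\<open>complex mat\<close>, whose rows and columns are
  indexed from 0, so that row \<open>i\<close> here is row \<open>i + 1\<close> in the usual 1-based numbering. The real
  sequences \<open>a\<close> and \<open>\<delta>\<close> keep their 1-based indices: only \<open>a 1, \<dots>, a (N - 1)\<close> and
  \<open>\<delta> 1, \<dots>, \<delta> N\<close> are used.
\<close>

definition lag_J :: "nat \<Rightarrow> complex mat" where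
  "lag_J N = Matrix.mat N N (\<lambda>(i, j). if i = j then of_nat (i + 1) else 0)"

definition lag_A :: "nat \<Rightarrow> (nat \<Rightarrow> real) \<Rightarrow> complex mat" where
  "lag_A N a = Matrix.mat N N (\<lambda>(i, j). if i = j + 1 then complex_of_real (a (j + 1)) else 0)"

definition lag_T :: "nat \<Rightarrow> real \<Rightarrow> (nat \<Rightarrow> real) \<Rightarrow> real \<Rightarrow> complex mat" where
  "lag_T N \<nu> \<delta> x = Matrix.mat N N (\<lambda>(i, j).
     if i = j then complex_of_real (exp (- x) * \<delta> (i + 1) * x powr (\<nu> + real (i + 1))) else 0)"

definition mat_exp :: "complex mat \<Rightarrow> complex mat" where
  "mat_exp M = Matrix.mat (dim_row M) (dim_row M)
     (\<lambda>(i, j). \<Sum>m. (M ^\<^sub>m m) $$ (i, j) / fact m)"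

definition lag_W :: "nat \<Rightarrow> real \<Rightarrow> (nat \<Rightarrow> real) \<Rightarrow> (nat \<Rightarrow> real) \<Rightarrow> real \<Rightarrow> complex mat" where
  "lag_W N \<nu> a \<delta> x =
     mat_exp (complex_of_real x \<cdot>\<^sub>m lag_A N a) * lag_T N \<nu> \<delta> x *
     mat_exp (complex_of_real x \<cdot>\<^sub>m mat_adjoint (lag_A N a))"

text \<open>
  Matrix polynomials in \<open>M\<^sub>N(\<complex>)[x]\<close> are represented as matrices with entries in \<open>\<complex>[x]\<close>.
\<close>

definition mat_poly_eval :: "complex poly mat \<Rightarrow> real \<Rightarrow> complex mat" where
  "mat_poly_eval p x = map_mat (\<lambda>q. poly q (complex_of_real x)) p"

definition mat_poly_const :: "complex mat \<Rightarrow> complex poly mat" where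
  "mat_poly_const M = map_mat (\<lambda>c. [:c:]) M"

definition monic_mat_poly :: "nat \<Rightarrow> nat \<Rightarrow> complex poly mat \<Rightarrow> bool" where
  "monic_mat_poly N n p \<longleftrightarrow>
     p \<in> carrier_mat N N \<and>
     (\<forall>i<N. \<forall>j<N. degree (p $$ (i, j)) \<le> n) \<and>
     map_mat (\<lambda>q. coeff q n) p = 1\<^sub>m N"

definition mat_integral :: "nat \<Rightarrow> (real \<Rightarrow> complex mat) \<Rightarrow> complex mat" where
  "mat_integral N F = Matrix.mat N N (\<lambda>(i, j). LINT x:{0..}|lborel. F x $$ (i, j))"

definition mat_inv :: "complex mat \<Rightarrow> complex mat" where
  "mat_inv M = the (mat_inverse M)"

definition mat_commutator :: "complex mat \<Rightarrow> complex mat \<Rightarrow> complex mat" where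
  "mat_commutator X Y = X * Y - Y * X"

text \<open>
  The recurrence \<open>x P(x,n) = P(x,n+1) + B\<^sub>n P(x,n) + C\<^sub>n P(x,n-1)\<close> with
  \<open>C\<^sub>n = H\<^sub>n H\<^sub>n\<^sub>-\<^sub>1\<^sup>-\<^sup>1\<close> and \<open>P(x,-1) = 0\<close>, as an identity of matrix polynomials. For given
  \<open>P\<close> and \<open>H\<close> it determines \<open>B\<close>.
\<close>

definition recurrence ::
  "nat \<Rightarrow> (nat \<Rightarrow> complex poly mat) \<Rightarrow> (nat \<Rightarrow> complex mat) \<Rightarrow> (nat \<Rightarrow> complex mat) \<Rightarrow> bool" where
  "recurrence N P H B \<longleftrightarrow>
     (\<forall>n. B n \<in> carrier_mat N N \<and>
       [:0, 1:] \<cdot>\<^sub>m P n =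
         P (n + 1) + mat_poly_const (B n) * P n +
         (if n = 0 then 0\<^sub>m N N
          else mat_poly_const (H n * mat_inv (H (n - 1))) * P (n - 1)))"

text \<open>
  Sign correction: the identity for \<open>2 H\<^sub>n H\<^sub>n\<^sub>-\<^sub>1\<^sup>-\<^sup>1\<close> is used with last term
  \<open>+ H\<^sub>n (A\<^sup>t - 1) H\<^sub>n\<^sub>-\<^sub>1\<^sup>-\<^sup>1 B\<^sub>n\<^sub>-\<^sub>1\<close>, not with the minus sign of the informal statement, which
  makes it false: for \<open>N = 1\<close> one has \<open>A = 0\<close>, \<open>C\<^sub>n = n (n + \<nu> + 1)\<close> and \<open>B\<^sub>n = 2 n + \<nu> + 2\<close>, and the
  version with minus would read \<open>2 C\<^sub>n = C\<^sub>n (B\<^sub>n + B\<^sub>n\<^sub>-\<^sub>1) = C\<^sub>n (4 n + 2 \<nu> + 2)\<close>, whereas the one with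
  plus reads \<open>2 C\<^sub>n = C\<^sub>n (B\<^sub>n - B\<^sub>n\<^sub>-\<^sub>1)\<close>, which holds.
\<close>

end

theory Submission
  imports Defs
begin

text \<open>
  As \<open>A\<close> is nilpotent, \<open>U = e\<^sup>A\<^sup>x\<close> is a matrix polynomial, and the weight is \<open>W = U T U\<^sup>*\<close> with \<open>T\<close> diagonal.
  Replacing a matrix polynomial \<open>F\<close> by \<open>F U\<close> therefore turns the pairing \<open>\<langle>F, G\<rangle> = \<integral> F W G\<^sup>*\<close> into
  scalar integrals against \<open>x\<^sup>s e\<^sup>-\<^sup>x\<close> with \<open>s = \<nu> + k\<close> in column \<open>k\<close>. For such a scalar weight, minus the
  adjoint of \<open>x f' - x f\<close> is \<open>x f' + (s + 1) f\<close>, and \<open>x f'' + (s + 1 - x) f' - k f\<close> is symmetric.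
  Since \<open>U' = A U\<close> and \<open>J U = U J + x U'\<close>, undoing the substitution gives three operators with
  polynomial coefficients that act from the right on matrix polynomials:
  the raising operator \<open>x (F' + F (A - 1))\<close>,
  the Euler operator \<open>x F' + F (\<nu> + 1 + J)\<close>, which is minus the adjoint of the raising operator,
  and the symmetric operator \<open>x F'' + F' (\<nu> + 1 + J + x (A - 1)) + F (A (\<nu> + 1 + J) - J)\<close>, which maps
  monic polynomials of degree \<open>n\<close> to polynomials whose coefficient of \<open>x\<^sup>n\<close> is \<open>\<Gamma>\<^sub>n\<close>.

  Pairing a polynomial of degree at most \<open>m\<close> with \<open>P\<^sub>m\<close> yields its coefficient of \<open>x\<^sup>m\<close> times \<open>H\<^sub>m\<close>
  (lemma \<open>weighted_form_P_right\<close>). Write \<open>P\<^sub>n = x\<^sup>n + p\<^sub>n x\<^sup>n\<^sup>-\<^sup>1 + q\<^sub>n x\<^sup>n\<^sup>-\<^sup>2 + \<dots>\<close>,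
  \<open>h\<^sub>n = H\<^sub>n J H\<^sub>n\<^sup>-\<^sup>1\<close> and \<open>Y\<^sub>n = H\<^sub>n (A - 1)\<^sup>* H\<^sub>n\<^sub>-\<^sub>1\<^sup>-\<^sup>1\<close>. Evaluating pairings of an operator applied to one
  \<open>P\<close> with another one on both sides gives
  \<open>\<Gamma>\<^sub>n H\<^sub>n = H\<^sub>n \<Gamma>\<^sub>n\<^sup>*\<close> (\<open>Gamma_H\<close>),
  \<open>h\<^sub>n = (A - 1) p\<^sub>n\<^sub>+\<^sub>1 - p\<^sub>n (A - 1) - (2 n + \<nu> + 1)\<close> (\<open>h_eq\<close>),
  \<open>Y\<^sub>n = p\<^sub>n + [J, p\<^sub>n]\<close> (\<open>Y_eq\<close>) and
  \<open>2 q\<^sub>n + [J, q\<^sub>n] = Y\<^sub>n p\<^sub>n\<^sub>-\<^sub>1\<close> (\<open>subsubleading_eq\<close>),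
  while the recurrence says \<open>B\<^sub>n = p\<^sub>n - p\<^sub>n\<^sub>+\<^sub>1\<close> and \<open>C\<^sub>n = q\<^sub>n - q\<^sub>n\<^sub>+\<^sub>1 - B\<^sub>n p\<^sub>n\<close>. With \<open>[J, A] = A\<close>, the first
  four identities follow by eliminating everything in favour of \<open>p\<close> and \<open>q\<close>. The last three follow
  from \<open>[J, A] = A\<close> and \<open>Gamma_H\<close>, which moves \<open>\<Gamma>\<close> through \<open>H\<close> at the cost of an adjoint.
\<close>

section \<open>Scalar Laguerre weights\<close>

text \<open>
  Integrals of products of the diagonal entries of the weight with polynomials are of this form,
  with \<open>s = \<nu> + k\<close> for the \<open>k\<close>-th entry.
\<close>

definition laguerre_integral :: "real \<Rightarrow> complex poly \<Rightarrow> complex" where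
  "laguerre_integral s p = (LINT x:{0..}|lborel. poly p (of_real x) * of_real (exp (- x) * x powr s))"

lemma has_bochner_integral_Gamma:
  fixes s :: real
  assumes "s > -1"
  shows "has_bochner_integral lborel (\<lambda>x. indicator {0..} x * (exp (- x) * x powr s)) (Gamma (s + 1))"
proof (rule has_bochner_integral_nn_integral)
  have "Gamma (s + 1) = (\<integral>\<^sup>+x. ennreal (indicator {0..} x * x powr (s + 1 - 1) / exp x) \<partial>lborel)"
    using assms by (intro Gamma_conv_nn_integral_real) auto
  thus "(\<integral>\<^sup>+x. ennreal (indicator {0..} x * (exp (- x) * x powr s)) \<partial>lborel) = ennreal (Gamma (s + 1))"
    by (simp add: exp_minus field_simps)
  show "0 \<le> Gamma (s + 1)" using Gamma_real_pos[of "s + 1"] assms by simp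
qed (auto simp: indicator_def)

text \<open>
  Induction on the polynomial with \<open>s\<close> arbitrary: multiplying the polynomial by \<open>x\<close> is the same as
  raising \<open>s\<close> by one.
\<close>

lemma laguerre_integral_integrable:
  assumes "s > -1"
  shows "set_integrable lborel {0..} (\<lambda>x. poly p (of_real x) * complex_of_real (exp (- x) * x powr s))"
  using assms
proof (induction p arbitrary: s)
  case 0
  then show ?case by (simp add: set_integrable_def)
next
  case (pCons a q)
  have 1: "set_integrable lborel {0..} (\<lambda>x. a * complex_of_real (exp (- x) * x powr s))"
    using has_bochner_integral_Gamma[OF pCons.prems, THEN has_bochner_integral_of_real, where 'a=complex]
    unfolding set_integrable_def
    by (auto simp: has_bochner_integral_iff scaleR_conv_of_real mult_ac intro: integrable_mult_right)
  have "set_integrable lborel {0..} (\<lambda>x. a * complex_of_real (exp (- x) * x powr s) +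
          poly q (of_real x) * complex_of_real (exp (- x) * x powr (s + 1)))"
    using pCons.prems by (intro set_integral_add 1 pCons.IH) auto
  also have "?this \<longleftrightarrow> ?case"
    by (intro set_integrable_cong) (auto simp: powr_add algebra_simps)
  finally show ?case .
qed

lemma laguerre_integral_0 [simp]: "laguerre_integral s 0 = 0"
  by (simp add: laguerre_integral_def)

lemma laguerre_integral_add:
  assumes "s > -1"
  shows "laguerre_integral s (p + q) = laguerre_integral s p + laguerre_integral s q"
  unfolding laguerre_integral_def poly_add distrib_right
  by (rule set_integral_add(2)) (intro laguerre_integral_integrable assms)+

lemma laguerre_integral_smult: "laguerre_integral s (Polynomial.smult c p) = c * laguerre_integral s p"
  unfolding laguerre_integral_def by (simp add: mult.assoc)

lemma laguerre_integral_minus: "laguerre_integral s (- p) = - laguerre_integral s p"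
  using laguerre_integral_smult[of s "-1" p] by simp

lemma laguerre_integral_diff: "s > -1 \<Longrightarrow> laguerre_integral s (p - q) = laguerre_integral s p - laguerre_integral s q"
  using laguerre_integral_add[of s p "- q"] by (simp add: laguerre_integral_minus)

lemma laguerre_integral_sum: "s > -1 \<Longrightarrow> laguerre_integral s (\<Sum>i\<in>S. f i) = (\<Sum>i\<in>S. laguerre_integral s (f i))"
  by (induction S rule: infinite_finite_induct) (auto simp: laguerre_integral_add)

lemma laguerre_integral_const: "s > -1 \<Longrightarrow> laguerre_integral s [:c:] = c * of_real (Gamma (s + 1))"
  using has_bochner_integral_Gamma[of s, THEN has_bochner_integral_of_real, where 'a=complex]
  by (simp add: laguerre_integral_def set_lebesgue_integral_def has_bochner_integral_iff scaleR_conv_of_real mult_ac)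

lemma laguerre_integral_shift: "s > -1 \<Longrightarrow> laguerre_integral s (pCons 0 p) = laguerre_integral (s + 1) p"
  unfolding laguerre_integral_def
  by (rule set_lebesgue_integral_cong) (auto simp: powr_add algebra_simps)

lemma laguerre_integral_pCons:
  assumes "s > -1"
  shows "laguerre_integral s (pCons a q) = a * of_real (Gamma (s + 1)) + laguerre_integral (s + 1) q"
proof -
  have "laguerre_integral s ([:a:] + pCons 0 q) = a * of_real (Gamma (s + 1)) + laguerre_integral (s + 1) q"
    by (simp only: laguerre_integral_add[OF assms] laguerre_integral_const[OF assms] laguerre_integral_shift[OF assms])
  thus ?thesis by simp
qed

lemma laguerre_integral_pCons_0_linear:
  assumes "s > -1"
  shows "laguerre_integral s (pCons 0 (p + q)) = laguerre_integral s (pCons 0 p) + laguerre_integral s (pCons 0 q)"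
    and "laguerre_integral s (pCons 0 (p - q)) = laguerre_integral s (pCons 0 p) - laguerre_integral s (pCons 0 q)"
  using assms by (simp_all add: laguerre_integral_pCons laguerre_integral_add laguerre_integral_diff)

text \<open>
  This is \<open>\<integral> (x p(x) x\<^sup>s e\<^sup>-\<^sup>x)' dx = 0\<close>, the only integration by parts that the whole development
  rests on. Since the moments are values of the Gamma function, it amounts to
  \<open>\<Gamma>(s + 2) = (s + 1) \<Gamma>(s + 1)\<close>, and no boundary terms have to be estimated.
\<close>

lemma laguerre_integral_by_parts:
  assumes "s > -1"
  shows "laguerre_integral s (pCons 0 (pderiv p)) + of_real (s + 1) * laguerre_integral s p - laguerre_integral s (pCons 0 p) = 0"
  using assms
proof (induction p arbitrary: s)
  case (pCons a q)
  have s: "s > -1" "s + 1 > -1" using pCons.prems by auto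
  have G: "Gamma (s + 2) = (s + 1) * Gamma (s + 1)"
  proof -
    have "s + 1 \<notin> \<int>\<^sub>\<le>\<^sub>0" using s by (auto elim!: nonpos_Ints_cases)
    thus ?thesis using Gamma_plus1[of "s + 1"] by (simp add: algebra_simps)
  qed
  show ?case
    using pCons.IH[OF s(2)] s
    by (simp add: pderiv_pCons laguerre_integral_pCons laguerre_integral_add G algebra_simps)
qed simp

lemma poly_map_cnj_of_real: "poly (map_poly cnj p) (of_real x) = cnj (poly p (of_real x))"
  by (induction p) (auto simp: map_poly_pCons)

lemma laguerre_integral_cnj: "laguerre_integral s (map_poly cnj p) = cnj (laguerre_integral s p)"
  unfolding laguerre_integral_def set_lebesgue_integral_def poly_map_cnj_of_real
  by (subst Bochner_Integration.integral_cnj[symmetric]) (simp add: scaleR_conv_of_real)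

text \<open>
  The integrand \<open>|p|\<^sup>2 x\<^sup>s e\<^sup>-\<^sup>x\<close> is nonnegative and vanishes on \<open>[0, 1]\<close> only at \<open>0\<close> and at the finitely
  many roots of \<open>p\<close>.
\<close>

lemma laguerre_integral_norm_nonzero:
  assumes "s > -1" "p \<noteq> 0"
  shows "\<exists>r>0. laguerre_integral s (p * map_poly cnj p) = of_real r"
proof -
  define f where "f = (\<lambda>x::real. indicator {0..} x * ((cmod (poly p (of_real x)))\<^sup>2 * (exp (- x) * x powr s)))"
  have eq: "indicator {0..} x *\<^sub>R (poly (p * map_poly cnj p) (of_real x) * complex_of_real (exp (- x) * x powr s))
       = complex_of_real (f x)" for x
    by (simp add: f_def scaleR_conv_of_real poly_map_cnj_of_real complex_norm_square flip: of_real_power)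
  have int: "integrable lborel (\<lambda>x. complex_of_real (f x))"
    using laguerre_integral_integrable[OF assms(1), of "p * map_poly cnj p"] unfolding set_integrable_def eq .
  hence int': "integrable lborel f" by (simp only: complex_of_real_integrable_eq)
  have val: "laguerre_integral s (p * map_poly cnj p) = of_real (integral\<^sup>L lborel f)"
    unfolding laguerre_integral_def set_lebesgue_integral_def eq by simp
  have nn: "f x \<ge> 0" for x by (simp add: f_def)
  have "integral\<^sup>L lborel f \<noteq> 0"
  proof
    assume "integral\<^sup>L lborel f = 0"
    hence ae: "AE x in lborel. f x = 0"
      using integral_nonneg_eq_0_iff_AE[OF int'] nn by simp
    let ?Z = "insert 0 (complex_of_real -` {z. poly p z = 0})"
    have "finite (complex_of_real -` {z. poly p z = 0})"
      by (intro finite_vimageI poly_roots_finite assms injI) auto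
    hence "finite ?Z" by simp
    hence "AE x in lborel. x \<notin> ?Z"
      by (intro AE_not_in finite_imp_null_set_lborel)
    with ae have "AE x in lborel. x \<notin> {0..1::real}"
    proof eventually_elim
      case (elim x)
      thus ?case by (auto simp: f_def indicator_def)
    qed
    hence "emeasure lborel {0..1::real} = 0"
      by (subst (asm) AE_iff_null_sets[symmetric]) (simp_all add: null_setsD1)
    thus False by simp
  qed
  moreover have "integral\<^sup>L lborel f \<ge> 0" using nn by simp
  ultimately show ?thesis using val by (intro exI[of _ "integral\<^sup>L lborel f"]) auto
qed

section \<open>Matrices and matrix polynomials\<close>

lemma mat_adjoint_carrier [simp, intro]: "M \<in> carrier_mat m n \<Longrightarrow> mat_adjoint M \<in> carrier_mat n m"
  by (auto simp: mat_adjoint_def mat_of_rows_def)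

lemma mat_adjoint_index [simp]:
  "i < dim_col M \<Longrightarrow> j < dim_row M \<Longrightarrow> mat_adjoint M $$ (i, j) = conjugate (M $$ (j, i))"
  by (simp add: mat_adjoint_def mat_of_rows_def)

lemma mat_adjoint_dim [simp]:
  "dim_row (mat_adjoint M) = dim_col M" "dim_col (mat_adjoint M) = dim_row M"
  by (auto simp: mat_adjoint_def mat_of_rows_def)

lemma mat_adjoint_minus:
  fixes A B :: "complex mat"
  shows "A \<in> carrier_mat m n \<Longrightarrow> B \<in> carrier_mat m n \<Longrightarrow> mat_adjoint (A - B) = mat_adjoint A - mat_adjoint B"
  by (intro eq_matI) auto

lemma mat_adjoint_mult:
  fixes A B :: "complex mat"
  shows "A \<in> carrier_mat l m \<Longrightarrow> B \<in> carrier_mat m n \<Longrightarrow> mat_adjoint (A * B) = mat_adjoint B * mat_adjoint A"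
  by (intro eq_matI) (auto simp: scalar_prod_def mult_ac)

lemma index_mult_mat_sum:
  "A \<in> carrier_mat l m \<Longrightarrow> B \<in> carrier_mat m n \<Longrightarrow> i < l \<Longrightarrow> j < n \<Longrightarrow>
    (A * B) $$ (i, j) = (\<Sum>k<m. A $$ (i, k) * B $$ (k, j))"
  by (auto simp: scalar_prod_def atLeast0LessThan)

definition mat_coeff :: "complex poly mat \<Rightarrow> nat \<Rightarrow> complex mat" where
  "mat_coeff F k = map_mat (\<lambda>q. coeff q k) F"

abbreviation mat_pderiv :: "complex poly mat \<Rightarrow> complex poly mat" where
  "mat_pderiv F \<equiv> map_mat pderiv F"

abbreviation mat_shift :: "complex poly mat \<Rightarrow> complex poly mat" where
  "mat_shift F \<equiv> [:0, 1:] \<cdot>\<^sub>m F"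

lemma mat_coeff_carrier [simp, intro]: "F \<in> carrier_mat m n \<Longrightarrow> mat_coeff F k \<in> carrier_mat m n"
  by (simp add: mat_coeff_def)

lemma mat_poly_const_carrier [simp, intro]: "M \<in> carrier_mat m n \<Longrightarrow> mat_poly_const M \<in> carrier_mat m n"
  by (simp add: mat_poly_const_def)

lemma mat_coeff_add: "F \<in> carrier_mat m n \<Longrightarrow> G \<in> carrier_mat m n \<Longrightarrow>
    mat_coeff (F + G) k = mat_coeff F k + mat_coeff G k"
  by (intro eq_matI) (auto simp: mat_coeff_def)

lemma mat_coeff_minus: "F \<in> carrier_mat m n \<Longrightarrow> G \<in> carrier_mat m n \<Longrightarrow>
    mat_coeff (F - G) k = mat_coeff F k - mat_coeff G k"
  by (intro eq_matI) (auto simp: mat_coeff_def)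

lemma mat_coeff_const_mult: "M \<in> carrier_mat l m \<Longrightarrow> F \<in> carrier_mat m n \<Longrightarrow>
    mat_coeff (mat_poly_const M * F) k = M * mat_coeff F k"
  by (intro eq_matI) (auto simp: mat_coeff_def mat_poly_const_def scalar_prod_def coeff_sum)

lemma mat_coeff_mult_const: "F \<in> carrier_mat l m \<Longrightarrow> M \<in> carrier_mat m n \<Longrightarrow>
    mat_coeff (F * mat_poly_const M) k = mat_coeff F k * M"
  by (intro eq_matI) (auto simp: mat_coeff_def mat_poly_const_def scalar_prod_def coeff_sum mult.commute)

lemma mat_coeff_shift_0: "F \<in> carrier_mat m n \<Longrightarrow> mat_coeff (mat_shift F) 0 = 0\<^sub>m m n"
  by (intro eq_matI) (auto simp: mat_coeff_def)

lemma mat_coeff_shift_Suc: "mat_coeff (mat_shift F) (Suc k) = mat_coeff F k"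
  by (intro eq_matI) (auto simp: mat_coeff_def)

lemma mat_coeff_pderiv: "mat_coeff (mat_pderiv F) k = of_nat (Suc k) \<cdot>\<^sub>m mat_coeff F (Suc k)"
  by (intro eq_matI) (auto simp: mat_coeff_def coeff_pderiv)

lemma mat_coeff_shift_pderiv: "mat_coeff (mat_shift (mat_pderiv F)) k = of_nat k \<cdot>\<^sub>m mat_coeff F k"
  by (cases k; intro eq_matI) (auto simp: mat_coeff_def coeff_pderiv)

lemma mat_poly_eqI:
  assumes "F \<in> carrier_mat m n" "G \<in> carrier_mat m n" "\<And>k. mat_coeff F k = mat_coeff G k"
  shows "F = G"
proof (rule eq_matI)
  fix i j assume ij: "i < dim_row G" "j < dim_col G"
  have "coeff (F $$ (i, j)) k = coeff (G $$ (i, j)) k" for k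
    using arg_cong[OF assms(3)[of k], of "\<lambda>M. M $$ (i, j)"] ij assms(1,2) by (auto simp: mat_coeff_def)
  thus "F $$ (i, j) = G $$ (i, j)" by (intro poly_eqI)
qed (use assms in auto)

lemma mat_pderiv_mult:
  "F \<in> carrier_mat l m \<Longrightarrow> G \<in> carrier_mat m n \<Longrightarrow>
   mat_pderiv (F * G) = mat_pderiv F * G + F * mat_pderiv G"
  by (intro eq_matI) (auto simp: scalar_prod_def pderiv_sum pderiv_mult sum.distrib algebra_simps)

lemma monic_mat_poly_coeff:
  assumes "monic_mat_poly N n F"
  shows "F \<in> carrier_mat N N" "mat_coeff F n = 1\<^sub>m N" "k > n \<Longrightarrow> mat_coeff F k = 0\<^sub>m N N"
proof -
  show "F \<in> carrier_mat N N" "mat_coeff F n = 1\<^sub>m N"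
    using assms by (auto simp: monic_mat_poly_def mat_coeff_def)
  assume "k > n"
  thus "mat_coeff F k = 0\<^sub>m N N" using assms
    by (intro eq_matI) (auto simp: monic_mat_poly_def mat_coeff_def intro!: coeff_eq_0 le_less_trans[of _ n k])
qed

lemma mat_inv_inverts:
  assumes "M \<in> carrier_mat N N" "det M \<noteq> 0"
  shows "mat_inv M \<in> carrier_mat N N" "M * mat_inv M = 1\<^sub>m N" "mat_inv M * M = 1\<^sub>m N"
proof -
  have "M \<in> Units (ring_mat TYPE(complex) N ())"
    using assms by (simp add: det_non_zero_imp_unit)
  then obtain B where "mat_inverse M = Some B"
    using mat_inverse(1)[OF assms(1), where b = "()"] by (cases "mat_inverse M") auto
  with mat_inverse(2)[OF assms(1) this]
  show "mat_inv M \<in> carrier_mat N N" "M * mat_inv M = 1\<^sub>m N" "mat_inv M * M = 1\<^sub>m N"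
    by (auto simp: mat_inv_def)
qed

section \<open>The exponential as a matrix polynomial\<close>

text \<open>
  The entry in row \<open>i\<close> and column \<open>j \<le> i\<close> of \<open>e\<^sup>A\<^sup>x\<close> is this number times \<open>x\<^sup>i\<^sup>-\<^sup>j\<close>: the only power of
  \<open>A\<close> that can be nonzero there is the \<open>(i - j)\<close>-th, and its entry is the product of the \<open>a k\<close> passed on the way from
  column \<open>j\<close> to row \<open>i\<close>.
\<close>

definition exp_entry :: "(nat \<Rightarrow> real) \<Rightarrow> nat \<Rightarrow> nat \<Rightarrow> complex" where
  "exp_entry a i j = of_real (\<Prod>k\<in>{j+1..i}. a k) / fact (i - j)"

definition exp_poly :: "nat \<Rightarrow> (nat \<Rightarrow> real) \<Rightarrow> complex poly mat" where
  "exp_poly N a = Matrix.mat N N (\<lambda>(i, j). if j \<le> i then monom (exp_entry a i j) (i - j) else 0)"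

lemma exp_poly_carrier [simp, intro]: "exp_poly N a \<in> carrier_mat N N"
  by (simp add: exp_poly_def)

lemma lag_A_carrier [simp, intro]: "lag_A N a \<in> carrier_mat N N"
  by (simp add: lag_A_def)

lemma lag_J_carrier [simp, intro]: "lag_J N \<in> carrier_mat N N"
  by (simp add: lag_J_def)

lemma lag_A_mult_left:
  assumes "F \<in> carrier_mat N N" "i < N" "j < N"
  shows "(mat_poly_const (lag_A N a) * F) $$ (i, j) = (if i = 0 then 0 else Polynomial.smult (of_real (a i)) (F $$ (i - 1, j)))"
proof -
  have "(mat_poly_const (lag_A N a) * F) $$ (i, j) =
      (\<Sum>k<N. [:if i = k + 1 then complex_of_real (a (k + 1)) else 0:] * F $$ (k, j))"
    using assms by (subst index_mult_mat_sum[of _ N N _ N]) (auto simp: mat_poly_const_def lag_A_def intro!: sum.cong)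
  also have "\<dots> = (\<Sum>k<N. if k = i - 1 then (if i = 0 then 0 else Polynomial.smult (of_real (a i)) (F $$ (i - 1, j))) else 0)"
    by (intro sum.cong) auto
  also have "\<dots> = (if i = 0 then 0 else Polynomial.smult (of_real (a i)) (F $$ (i - 1, j)))"
    using assms by (subst sum.delta) auto
  finally show ?thesis .
qed

lemma of_nat_mult_div_fact_Suc: "of_nat (Suc d) * (c / fact (Suc d)) = (c / fact d :: complex)"
  by (simp add: fact_Suc del: of_nat_Suc)

lemma exp_entry_rec_left:
  assumes "j < i"
  shows "of_nat (i - j) * exp_entry a i j = of_real (a i) * exp_entry a (i - 1) j"
proof -
  obtain d where d: "i = Suc (j + d)" using assms less_iff_Suc_add by auto
  have "Suc (j + d) - j = Suc d" by simp
  thus ?thesis unfolding exp_entry_def d by (simp only: of_nat_mult_div_fact_Suc) simp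
qed

lemma pderiv_exp_poly_left: "mat_pderiv (exp_poly N a) = mat_poly_const (lag_A N a) * exp_poly N a"
proof (rule eq_matI)
  fix i j assume "i < dim_row (mat_poly_const (lag_A N a) * exp_poly N a)" "j < dim_col (mat_poly_const (lag_A N a) * exp_poly N a)"
  hence ij: "i < N" "j < N" by (auto simp: mat_poly_const_def lag_A_def exp_poly_def)
  show "mat_pderiv (exp_poly N a) $$ (i, j) = (mat_poly_const (lag_A N a) * exp_poly N a) $$ (i, j)"
    using ij exp_entry_rec_left[of j i a]
    by (subst lag_A_mult_left) (auto simp: exp_poly_def pderiv_monom smult_monom mult.commute)
qed (auto simp: mat_poly_const_def lag_A_def exp_poly_def)

lemma lag_J_mult_right:
  assumes "F \<in> carrier_mat N N" "i < N" "j < N"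
  shows "(F * mat_poly_const (lag_J N)) $$ (i, j) = Polynomial.smult (of_nat (j + 1)) (F $$ (i, j))"
proof -
  have "(F * mat_poly_const (lag_J N)) $$ (i, j) = (\<Sum>k<N. F $$ (i, k) * [:if k = j then of_nat (j + 1) else 0:])"
    using assms by (subst index_mult_mat_sum[of _ N N _ N]) (auto simp: mat_poly_const_def lag_J_def intro!: sum.cong)
  also have "\<dots> = (\<Sum>k<N. if k = j then Polynomial.smult (of_nat (j + 1)) (F $$ (i, j)) else 0)"
    by (intro sum.cong) auto
  finally show ?thesis using assms by simp
qed

lemma lag_J_mult_left:
  assumes "F \<in> carrier_mat N N" "i < N" "j < N"
  shows "(mat_poly_const (lag_J N) * F) $$ (i, j) = Polynomial.smult (of_nat (i + 1)) (F $$ (i, j))"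
proof -
  have "(mat_poly_const (lag_J N) * F) $$ (i, j) = (\<Sum>k<N. [:if k = i then of_nat (i + 1) else 0:] * F $$ (k, j))"
    using assms by (subst index_mult_mat_sum[of _ N N _ N]) (auto simp: mat_poly_const_def lag_J_def intro!: sum.cong)
  also have "\<dots> = (\<Sum>k<N. if k = i then Polynomial.smult (of_nat (i + 1)) (F $$ (i, j)) else 0)"
    by (intro sum.cong) auto
  finally show ?thesis using assms by simp
qed

text \<open>
  The \<open>(i, j)\<close> entry of \<open>e\<^sup>A\<^sup>x\<close> is homogeneous of degree \<open>i - j\<close>. Commuting with \<open>J\<close> multiplies it by
  \<open>i - j\<close>, and so does the Euler operator \<open>x d/dx\<close>. Hence \<open>J e\<^sup>A\<^sup>x = e\<^sup>A\<^sup>x J + x (e\<^sup>A\<^sup>x)'\<close>.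
\<close>

lemma lag_J_exp_poly:
  "mat_poly_const (lag_J N) * exp_poly N a =
     exp_poly N a * mat_poly_const (lag_J N) + mat_shift (mat_pderiv (exp_poly N a))"
proof (rule eq_matI)
  fix i j assume "i < dim_row (exp_poly N a * mat_poly_const (lag_J N) + mat_shift (mat_pderiv (exp_poly N a)))"
    "j < dim_col (exp_poly N a * mat_poly_const (lag_J N) + mat_shift (mat_pderiv (exp_poly N a)))"
  hence ij: "i < N" "j < N" by (auto simp: exp_poly_def)
  have ij_Suc: "i = j + Suc m" if "i - j = Suc m" for m using that by linarith
  have "Polynomial.smult (of_nat (i + 1)) (exp_poly N a $$ (i, j)) =
     Polynomial.smult (of_nat (j + 1)) (exp_poly N a $$ (i, j)) + pCons 0 (pderiv (exp_poly N a $$ (i, j)))"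
    using ij by (intro poly_eqI) (auto simp: exp_poly_def coeff_pderiv coeff_pCons of_nat_diff algebra_simps split: nat.splits dest!: ij_Suc)
  with ij show "(mat_poly_const (lag_J N) * exp_poly N a) $$ (i, j) =
     (exp_poly N a * mat_poly_const (lag_J N) + mat_shift (mat_pderiv (exp_poly N a))) $$ (i, j)"
    by (simp add: lag_J_mult_left lag_J_mult_right exp_poly_def[THEN arg_cong, of dim_row] exp_poly_def[THEN arg_cong, of dim_col]
      del: index_mult_mat(1))
qed (auto simp: mat_poly_const_def lag_J_def exp_poly_def)

lemma det_exp_poly: "det (exp_poly N a) = 1"
proof -
  have "det (exp_poly N a) = prod_list (diag_mat (exp_poly N a))"
    by (rule det_lower_triangular[of N]) (auto simp: exp_poly_def)
  also have "diag_mat (exp_poly N a) = replicate N 1"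
    by (intro nth_equalityI) (auto simp: diag_mat_def exp_poly_def exp_entry_def)
  finally show ?thesis by (simp add: prod_list_replicate)
qed

lemma pow_lag_A:
  "(complex_of_real x \<cdot>\<^sub>m lag_A N a) ^\<^sub>m m = Matrix.mat N N (\<lambda>(i, j).
     if i = j + m then of_real (x ^ m * (\<Prod>k\<in>{j+1..i}. a k)) else 0)"
proof (induction m)
  case 0
  show ?case by (intro eq_matI) (auto simp: lag_A_def)
next
  case (Suc m)
  show ?case
  proof (rule eq_matI)
    fix i j assume "i < dim_row (Matrix.mat N N (\<lambda>(i, j). if i = j + Suc m then complex_of_real (x ^ Suc m * (\<Prod>k\<in>{j+1..i}. a k)) else 0))"
      "j < dim_col (Matrix.mat N N (\<lambda>(i, j). if i = j + Suc m then complex_of_real (x ^ Suc m * (\<Prod>k\<in>{j+1..i}. a k)) else 0))"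
    hence ij: "i < N" "j < N" by auto
    have "((complex_of_real x \<cdot>\<^sub>m lag_A N a) ^\<^sub>m Suc m) $$ (i, j) =
        (\<Sum>k<N. (if i = k + m then of_real (x ^ m * (\<Prod>l\<in>{k+1..i}. a l)) else 0) *
               (if k = j + 1 then of_real (x * a (j + 1)) else 0))"
      using ij unfolding pow_mat.simps Suc.IH
      by (subst index_mult_mat_sum[of _ N N _ N]) (auto simp: lag_A_def intro!: sum.cong)
    also have "\<dots> = (\<Sum>k<N. if k = j + 1 then (if i = j + Suc m then of_real (x ^ Suc m * (\<Prod>l\<in>{j+1..i}. a l)) else 0) else 0)"
    proof (intro sum.cong refl)
      fix k
      have "i = j + Suc m \<Longrightarrow> {j+1..i} = insert (j+1) {j+1+1..i}" by auto
      thus "(if i = k + m then of_real (x ^ m * (\<Prod>l\<in>{k+1..i}. a l)) else 0) *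
               (if k = j + 1 then of_real (x * a (j + 1)) else 0) =
           (if k = j + 1 then (if i = j + Suc m then complex_of_real (x ^ Suc m * (\<Prod>l\<in>{j+1..i}. a l)) else 0) else 0)"
        by auto
    qed
    finally show "((complex_of_real x \<cdot>\<^sub>m lag_A N a) ^\<^sub>m Suc m) $$ (i, j) =
      Matrix.mat N N (\<lambda>(i, j). if i = j + Suc m then of_real (x ^ Suc m * (\<Prod>k\<in>{j+1..i}. a k)) else 0) $$ (i, j)"
      using ij by simp
  qed (auto simp: lag_A_def)
qed

lemma mat_adjoint_pow:
  fixes M :: "complex mat"
  assumes "M \<in> carrier_mat N N"
  shows "mat_adjoint (M ^\<^sub>m m) = mat_adjoint M ^\<^sub>m m"
proof (induction m)
  case 0
  show ?case using assms by (intro eq_matI) auto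
next
  case (Suc m)
  have "mat_adjoint (M ^\<^sub>m Suc m) = mat_adjoint M * mat_adjoint M ^\<^sub>m m"
    using assms by (simp add: mat_adjoint_mult[of _ N N _ N] Suc.IH)
  also have "\<dots> = mat_adjoint M ^\<^sub>m Suc m"
  proof (induction m)
    case (Suc m)
    have "mat_adjoint M * mat_adjoint M ^\<^sub>m Suc m = (mat_adjoint M * mat_adjoint M ^\<^sub>m m) * mat_adjoint M"
      using assoc_mult_mat[of "mat_adjoint M" N N "mat_adjoint M ^\<^sub>m m" N "mat_adjoint M" N] assms by simp
    thus ?case using Suc by simp
  qed (use assms in simp)
  finally show ?case .
qed

lemma mat_exp_lag_A:
  assumes "i < N" "j < N"
  shows "mat_exp (complex_of_real x \<cdot>\<^sub>m lag_A N a) $$ (i, j) = poly (exp_poly N a $$ (i, j)) (of_real x)"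
proof -
  let ?f = "\<lambda>m. ((complex_of_real x \<cdot>\<^sub>m lag_A N a) ^\<^sub>m m) $$ (i, j) / fact m"
  have f: "?f m = (if m = i - j then (if j \<le> i then of_real (x ^ m * (\<Prod>k\<in>{j+1..i}. a k)) / fact m else 0) else 0)" for m
    unfolding pow_lag_A using assms by auto
  have "suminf ?f = (if j \<le> i then of_real (x ^ (i - j) * (\<Prod>k\<in>{j+1..i}. a k)) / fact (i - j) else 0)"
    unfolding f by (rule sums_unique[OF sums_single, symmetric])
  thus ?thesis using assms
    by (auto simp: mat_exp_def lag_A_def exp_poly_def poly_monom exp_entry_def)
qed

text \<open>
  As \<open>a\<close> is real, \<open>e\<^sup>A\<^sup>*\<^sup>x\<close> is the conjugate transpose of \<open>e\<^sup>A\<^sup>x\<close>.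
\<close>

lemma mat_exp_adjoint_lag_A:
  assumes "i < N" "j < N"
  shows "mat_exp (complex_of_real x \<cdot>\<^sub>m mat_adjoint (lag_A N a)) $$ (i, j) =
    cnj (poly (exp_poly N a $$ (j, i)) (of_real x))"
proof -
  have adj: "complex_of_real x \<cdot>\<^sub>m mat_adjoint (lag_A N a) = mat_adjoint (complex_of_real x \<cdot>\<^sub>m lag_A N a)"
    by (intro eq_matI) (auto simp: lag_A_def)
  let ?f = "\<lambda>m. ((complex_of_real x \<cdot>\<^sub>m mat_adjoint (lag_A N a)) ^\<^sub>m m) $$ (i, j) / fact m"
  let ?g = "\<lambda>m. ((complex_of_real x \<cdot>\<^sub>m lag_A N a) ^\<^sub>m m) $$ (j, i) / fact m"
  have d: "dim_row ((complex_of_real x \<cdot>\<^sub>m lag_A N a) ^\<^sub>m m) = N" "dim_col ((complex_of_real x \<cdot>\<^sub>m lag_A N a) ^\<^sub>m m) = N" for m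
    by (simp_all add: pow_lag_A)
  have fg: "?f m = cnj (?g m)" for m
    unfolding adj using assms d
    by (subst mat_adjoint_pow[symmetric, of _ N]) auto
  have real: "cnj (?g m) = ?g m" for m
    unfolding pow_lag_A using assms by auto
  have "suminf ?f = suminf ?g" by (simp only: fg real)
  also have "\<dots> = mat_exp (complex_of_real x \<cdot>\<^sub>m lag_A N a) $$ (j, i)"
    using assms by (simp add: mat_exp_def lag_A_def)
  also have "\<dots> = poly (exp_poly N a $$ (j, i)) (of_real x)" by (rule mat_exp_lag_A) (use assms in auto)
  also have "\<dots> = cnj \<dots>"
    using assms by (auto simp: exp_poly_def poly_monom exp_entry_def)
  finally show ?thesis using assms by (simp add: mat_exp_def lag_A_def)
qed

section \<open>Arithmetic of square matrices\<close>

lemma dim_simps [simp]: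
  "dim_row (exp_poly N a) = N" "dim_col (exp_poly N a) = N"
  "dim_row (lag_A N a) = N" "dim_col (lag_A N a) = N"
  "dim_row (lag_J N) = N" "dim_col (lag_J N) = N"
  "dim_row (mat_poly_const M) = dim_row M" "dim_col (mat_poly_const M) = dim_col M"
  "dim_row (mat_poly_eval F x) = dim_row F" "dim_col (mat_poly_eval F x) = dim_col F"
  "dim_row (mat_exp M) = dim_row M" "dim_col (mat_exp M) = dim_row M"
  by (simp_all add: exp_poly_def lag_A_def lag_J_def mat_poly_const_def mat_poly_eval_def mat_exp_def)

text \<open>
  The rules of noncommutative ring arithmetic are stated for a fixed size \<open>N\<close>, so that rewriting
  with them brings every expression in \<open>N \<times> N\<close> matrices into a sum of right-associated products;
  matrix identities then reduce to commutative identities between entries in which these products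
  are atoms.
\<close>

lemma square_mat_closed:
  fixes X Y :: "'r :: comm_ring_1 mat"
  shows "X \<in> carrier_mat N N \<Longrightarrow> Y \<in> carrier_mat N N \<Longrightarrow> X + Y \<in> carrier_mat N N"
    "X \<in> carrier_mat N N \<Longrightarrow> Y \<in> carrier_mat N N \<Longrightarrow> X - Y \<in> carrier_mat N N"
    "X \<in> carrier_mat N N \<Longrightarrow> Y \<in> carrier_mat N N \<Longrightarrow> X * Y \<in> carrier_mat N N"
    "X \<in> carrier_mat N N \<Longrightarrow> - X \<in> carrier_mat N N"
    "X \<in> carrier_mat N N \<Longrightarrow> c \<cdot>\<^sub>m X \<in> carrier_mat N N"
    "1\<^sub>m N \<in> carrier_mat N N" "0\<^sub>m N N \<in> carrier_mat N N"
    "X \<in> carrier_mat N N \<Longrightarrow> map_mat h X \<in> carrier_mat N N"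
  by auto

lemma square_mat_distrib:
  fixes X Y Z :: "'r :: comm_ring_1 mat"
  assumes "X \<in> carrier_mat N N" "Y \<in> carrier_mat N N" "Z \<in> carrier_mat N N"
  shows "(X + Y) * Z = X * Z + Y * Z" "Z * (X + Y) = Z * X + Z * Y"
    "(X - Y) * Z = X * Z - Y * Z" "Z * (X - Y) = Z * X - Z * Y"
    "(X * Y) * Z = X * (Y * Z)"
  using assms
  by (auto simp: add_mult_distrib_mat[of _ N N _ _ N] mult_add_distrib_mat[of _ N N _ N]
    minus_mult_distrib_mat[of _ N N _ _ N] mult_minus_distrib_mat[of _ N N _ N])

lemma square_mat_scalar:
  fixes X Y :: "'r :: comm_ring_1 mat"
  assumes "X \<in> carrier_mat N N" "Y \<in> carrier_mat N N"
  shows "(- X) * Y = - (X * Y)" "X * (- Y) = - (X * Y)"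
    "(c \<cdot>\<^sub>m X) * Y = c \<cdot>\<^sub>m (X * Y)" "X * (c \<cdot>\<^sub>m Y) = c \<cdot>\<^sub>m (X * Y)"
  using assms
  by (auto simp: mult_smult_assoc_mat[of _ N N _ N] mult_smult_distrib[of _ N N _ N])

lemma square_mat_one:
  fixes X :: "'r :: comm_ring_1 mat"
  assumes "X \<in> carrier_mat N N"
  shows "1\<^sub>m N * X = X" "X * 1\<^sub>m N = X" "1 \<cdot>\<^sub>m X = X" "0\<^sub>m N N * X = 0\<^sub>m N N" "X * 0\<^sub>m N N = 0\<^sub>m N N"
    "0\<^sub>m N N + X = X" "X + 0\<^sub>m N N = X" "X - 0\<^sub>m N N = X" "0\<^sub>m N N - X = - X" "X - X = 0\<^sub>m N N"
    "- (- X) = X"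
  using assms by (auto intro!: eq_matI)

lemma square_mat_minus_eq_0_iff:
  fixes X Y :: "'r :: comm_ring_1 mat"
  assumes "X \<in> carrier_mat N N" "Y \<in> carrier_mat N N"
  shows "X - Y = 0\<^sub>m N N \<longleftrightarrow> X = Y"
  using assms by (auto simp: mat_eq_iff)

lemma mat_poly_const_add: "X \<in> carrier_mat m n \<Longrightarrow> Y \<in> carrier_mat m n \<Longrightarrow>
    mat_poly_const (X + Y) = mat_poly_const X + mat_poly_const Y"
  by (auto intro!: eq_matI simp: mat_poly_const_def)

lemma mat_poly_const_minus: "X \<in> carrier_mat m n \<Longrightarrow> Y \<in> carrier_mat m n \<Longrightarrow>
    mat_poly_const (X - Y) = mat_poly_const X - mat_poly_const Y"
  by (auto intro!: eq_matI simp: mat_poly_const_def)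

lemma mat_poly_const_mult:
  assumes "X \<in> carrier_mat l m" "Y \<in> carrier_mat m n"
  shows "mat_poly_const (X * Y) = mat_poly_const X * mat_poly_const Y"
proof -
  have sum_const: "(\<Sum>k\<in>S. [:f k:]) = [:\<Sum>k\<in>S. f k:]" for f :: "nat \<Rightarrow> complex" and S
    by (induction S rule: infinite_finite_induct) auto
  show ?thesis
    using assms by (intro eq_matI) (auto simp: mat_poly_const_def scalar_prod_def sum_const mult.commute)
qed

lemma mat_poly_const_smult: "mat_poly_const (c \<cdot>\<^sub>m X) = [:c:] \<cdot>\<^sub>m mat_poly_const X"
  by (auto intro!: eq_matI simp: mat_poly_const_def)

lemma mat_poly_const_one: "mat_poly_const (1\<^sub>m N) = 1\<^sub>m N"
  by (auto intro!: eq_matI simp: mat_poly_const_def one_pCons)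

lemma map_poly_cnj_hom:
  "map_poly cnj (p + q) = map_poly cnj p + map_poly cnj q"
  "map_poly cnj (p - q) = map_poly cnj p - map_poly cnj q"
  "map_poly cnj (p * q) = map_poly cnj p * map_poly cnj q"
  "map_poly cnj (Polynomial.smult c p) = Polynomial.smult (cnj c) (map_poly cnj p)"
  "map_poly cnj (pCons 0 p) = pCons 0 (map_poly cnj p)"
  "map_poly cnj (pderiv p) = pderiv (map_poly cnj p)"
  "map_poly cnj (map_poly cnj p) = p"
  by (intro poly_eqI; simp add: coeff_map_poly coeff_mult coeff_pCons coeff_pderiv split: nat.splits)+

lemma mat_poly_eval_carrier [simp, intro]: "F \<in> carrier_mat N N \<Longrightarrow> mat_poly_eval F x \<in> carrier_mat N N"
  by (simp add: mat_poly_eval_def)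

lemma mat_poly_eval_mult: "F \<in> carrier_mat N N \<Longrightarrow> G \<in> carrier_mat N N \<Longrightarrow>
    mat_poly_eval (F * G) x = mat_poly_eval F x * mat_poly_eval G x"
  by (intro eq_matI) (auto simp: mat_poly_eval_def scalar_prod_def poly_sum)

section \<open>The matrix weight as a sesquilinear form\<close>

locale laguerre_weight =
  fixes N :: nat and \<nu> :: real and a \<delta> :: "nat \<Rightarrow> real"
  assumes nu: "\<nu> > -1" and delta: "\<And>k. k \<in> {1..N} \<Longrightarrow> \<delta> k > 0"
begin

abbreviation "A \<equiv> lag_A N a"
abbreviation "J \<equiv> lag_J N"
abbreviation "I \<equiv> 1\<^sub>m N :: complex mat"
abbreviation "U \<equiv> exp_poly N a"
definition "\<sigma> k = \<nu> + real (k + 1)"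

lemmas mat_algebra = square_mat_closed[where N = N] square_mat_distrib[where N = N]
  square_mat_scalar[where N = N] square_mat_one[where N = N]
lemmas const_hom = mat_poly_const_add[of _ N N] mat_poly_const_minus[of _ N N]
  mat_poly_const_mult[of _ N N _ N] mat_poly_const_smult mat_poly_const_one

lemma sigma: "\<sigma> k > -1" using nu by (simp add: \<sigma>_def)

lemma of_real_sigma: "complex_of_real (\<sigma> k) = of_real \<nu> + of_nat k + 1"
  by (simp add: \<sigma>_def)

text \<open>
  The pairing of matrix polynomials after the substitution \<open>F \<mapsto> F e\<^sup>A\<^sup>x\<close>, under which the matrix weight
  becomes the diagonal of the scalar weights \<open>\<delta>\<^sub>k x\<^sup>\<nu>\<^sup>+\<^sup>k e\<^sup>-\<^sup>x\<close>.
\<close>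

definition weighted_form :: "complex poly mat \<Rightarrow> complex poly mat \<Rightarrow> complex mat" where
  "weighted_form F G = Matrix.mat N N (\<lambda>(i, j). \<Sum>k<N.
     of_real (\<delta> (k + 1)) * laguerre_integral (\<sigma> k) ((F * U) $$ (i, k) * map_poly cnj ((G * U) $$ (j, k))))"

lemma weighted_form_carrier [simp, intro]: "weighted_form F G \<in> carrier_mat N N"
  by (simp add: weighted_form_def)

lemma weighted_form_index: "i < N \<Longrightarrow> j < N \<Longrightarrow> weighted_form F G $$ (i, j) = (\<Sum>k<N.
     of_real (\<delta> (k + 1)) * laguerre_integral (\<sigma> k) ((F * U) $$ (i, k) * map_poly cnj ((G * U) $$ (j, k))))"
  by (simp add: weighted_form_def)

lemma weighted_form_dim [simp]: "dim_row (weighted_form F G) = N" "dim_col (weighted_form F G) = N"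
  by (simp_all add: weighted_form_def)

lemma weighted_product_index:
  assumes F: "F \<in> carrier_mat N N" and G: "G \<in> carrier_mat N N" and ij: "i < N" "j < N"
  shows "(mat_poly_eval F x * lag_W N \<nu> a \<delta> x * mat_adjoint (mat_poly_eval G x)) $$ (i, j) =
    (\<Sum>k<N. of_real (\<delta> (k + 1)) *
       (poly ((F * U) $$ (i, k) * map_poly cnj ((G * U) $$ (j, k))) (of_real x) *
        of_real (exp (- x) * x powr \<sigma> k)))"
proof -
  let ?E = "mat_poly_eval U x" and ?T = "lag_T N \<nu> \<delta> x"
  let ?F = "mat_poly_eval F x" and ?G = "mat_poly_eval G x"
  have T: "?T \<in> carrier_mat N N" by (simp add: lag_T_def)
  have E: "?E \<in> carrier_mat N N" by auto
  have E1: "mat_exp (complex_of_real x \<cdot>\<^sub>m A) = ?E"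
    by (rule eq_matI) (auto simp: mat_exp_lag_A mat_poly_eval_def)
  have E2: "mat_exp (complex_of_real x \<cdot>\<^sub>m mat_adjoint A) = mat_adjoint ?E"
    by (rule eq_matI) (auto simp: mat_exp_adjoint_lag_A mat_poly_eval_def)
  have "?F * lag_W N \<nu> a \<delta> x * mat_adjoint ?G = (?F * ?E) * ?T * (mat_adjoint ?E * mat_adjoint ?G)"
    unfolding lag_W_def E1 E2 using F G T E by (simp add: mat_algebra)
  also have "?F * ?E = mat_poly_eval (F * U) x"
    using F by (simp add: mat_poly_eval_mult)
  also have "mat_adjoint ?E * mat_adjoint ?G = mat_adjoint (mat_poly_eval (G * U) x)"
    using G E by (simp add: mat_poly_eval_mult mat_adjoint_mult[of _ N N _ N])
  also have "(mat_poly_eval (F * U) x * ?T * mat_adjoint (mat_poly_eval (G * U) x)) $$ (i, j) =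
     (\<Sum>k<N. (\<Sum>l<N. poly ((F * U) $$ (i, l)) (of_real x) * ?T $$ (l, k)) * cnj (poly ((G * U) $$ (j, k)) (of_real x)))"
    using F G T ij
    by (subst index_mult_mat_sum[of _ N N _ N])
       (auto simp: mat_poly_eval_def index_mult_mat_sum[of _ N N _ N] simp del: index_mult_mat(1) intro!: sum.cong)
  also have "\<dots> = (\<Sum>k<N. of_real (\<delta> (k + 1)) *
       (poly ((F * U) $$ (i, k) * map_poly cnj ((G * U) $$ (j, k))) (of_real x) *
        of_real (exp (- x) * x powr \<sigma> k)))"
  proof (rule sum.cong, rule refl)
    fix k assume k: "k \<in> {..<N}"
    have "(\<Sum>l<N. poly ((F * U) $$ (i, l)) (of_real x) * ?T $$ (l, k)) =
       (\<Sum>l<N. if l = k then poly ((F * U) $$ (i, k)) (of_real x) * ?T $$ (k, k) else 0)"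
      using k by (intro sum.cong) (auto simp: lag_T_def)
    also have "\<dots> = poly ((F * U) $$ (i, k)) (of_real x) * ?T $$ (k, k)"
      using k by simp
    finally show "(\<Sum>l<N. poly ((F * U) $$ (i, l)) (of_real x) * ?T $$ (l, k)) * cnj (poly ((G * U) $$ (j, k)) (of_real x)) =
       of_real (\<delta> (k + 1)) *
       (poly ((F * U) $$ (i, k) * map_poly cnj ((G * U) $$ (j, k))) (of_real x) *
        of_real (exp (- x) * x powr \<sigma> k))"
      using k by (simp add: poly_map_cnj_of_real lag_T_def \<sigma>_def mult_ac del: index_mult_mat(1))
  qed
  finally show ?thesis .
qed

lemma mat_integral_eq_weighted_form:
  assumes F: "F \<in> carrier_mat N N" and G: "G \<in> carrier_mat N N"
  shows "mat_integral N (\<lambda>x. mat_poly_eval F x * lag_W N \<nu> a \<delta> x * mat_adjoint (mat_poly_eval G x)) = weighted_form F G"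
proof (rule eq_matI)
  fix i j assume "i < dim_row (weighted_form F G)" "j < dim_col (weighted_form F G)"
  hence ij: "i < N" "j < N" by auto
  let ?g = "\<lambda>k x. poly ((F * U) $$ (i, k) * map_poly cnj ((G * U) $$ (j, k))) (of_real x) *
        complex_of_real (exp (- x) * x powr \<sigma> k)"
  have int: "integrable lborel (\<lambda>x. indicator {0..} x *\<^sub>R (of_real (\<delta> (k + 1)) * ?g k x))" for k
    using set_integrable_mult_right[OF laguerre_integral_integrable[OF sigma]]
    unfolding set_integrable_def by blast
  have "(LINT x:{0..}|lborel. (\<Sum>k<N. of_real (\<delta> (k + 1)) * ?g k x)) =
     (\<Sum>k<N. LINT x:{0..}|lborel. of_real (\<delta> (k + 1)) * ?g k x)"
    unfolding set_lebesgue_integral_def scaleR_sum_right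
    by (rule Bochner_Integration.integral_sum) (rule int)
  also have "\<dots> = weighted_form F G $$ (i, j)"
    unfolding weighted_form_index[OF ij] laguerre_integral_def by (intro sum.cong refl set_integral_mult_right)
  finally show "mat_integral N (\<lambda>x. mat_poly_eval F x * lag_W N \<nu> a \<delta> x * mat_adjoint (mat_poly_eval G x)) $$ (i, j) = weighted_form F G $$ (i, j)"
    using ij by (simp add: mat_integral_def weighted_product_index[OF F G ij])
qed (auto simp: mat_integral_def)

lemma weighted_form_adjoint:
  assumes F: "F \<in> carrier_mat N N" and G: "G \<in> carrier_mat N N"
  shows "mat_adjoint (weighted_form F G) = weighted_form G F"
  by (rule eq_matI) (auto simp: weighted_form_index laguerre_integral_cnj[symmetric] map_poly_cnj_hom mult.commute simp del: index_mult_mat(1))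

lemma weighted_form_minus_left:
  assumes "F \<in> carrier_mat N N" "F' \<in> carrier_mat N N"
  shows "weighted_form (F - F') G = weighted_form F G - weighted_form F' G"
  using assms
  by (intro eq_matI) (auto simp: weighted_form_index mat_algebra left_diff_distrib laguerre_integral_diff sigma right_diff_distrib sum_subtractf
     simp del: index_mult_mat(1))

lemma weighted_form_const_left:
  assumes M: "M \<in> carrier_mat N N" and F: "F \<in> carrier_mat N N"
  shows "weighted_form (mat_poly_const M * F) G = M * weighted_form F G"
proof (rule eq_matI)
  fix i j assume "i < dim_row (M * weighted_form F G)" "j < dim_col (M * weighted_form F G)"
  hence ij: "i < N" "j < N" using M by auto
  have 1: "(mat_poly_const M * F * U) $$ (i, k) = (\<Sum>l<N. Polynomial.smult (M $$ (i, l)) ((F * U) $$ (l, k)))" if "k < N" for k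
    using M F ij that
    by (subst square_mat_distrib(5)[of _ N]) (auto simp: mat_poly_const_def index_mult_mat_sum[of "map_mat (\<lambda>c. [:c:]) M" N N "F * U" N] simp del: index_mult_mat(1))
  have "weighted_form (mat_poly_const M * F) G $$ (i, j) = (\<Sum>k<N. \<Sum>l<N. M $$ (i, l) * (of_real (\<delta> (k + 1)) *
     laguerre_integral (\<sigma> k) ((F * U) $$ (l, k) * map_poly cnj ((G * U) $$ (j, k)))))"
    unfolding weighted_form_index[OF ij]
    by (intro sum.cong refl)
       (simp add: 1 sum_distrib_right laguerre_integral_sum sigma laguerre_integral_smult sum_distrib_left mult_ac del: index_mult_mat(1))
  also have "\<dots> = (\<Sum>l<N. M $$ (i, l) * weighted_form F G $$ (l, j))"
    by (subst sum.swap) (simp add: weighted_form_index ij sum_distrib_left del: index_mult_mat(1))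
  also have "\<dots> = (M * weighted_form F G) $$ (i, j)"
    using M ij by (subst index_mult_mat_sum[of _ N N _ N]) auto
  finally show "weighted_form (mat_poly_const M * F) G $$ (i, j) = (M * weighted_form F G) $$ (i, j)" .
qed (use M in auto)

lemma weighted_form_const_right:
  assumes M: "M \<in> carrier_mat N N" and F: "F \<in> carrier_mat N N" and G: "G \<in> carrier_mat N N"
  shows "weighted_form F (mat_poly_const M * G) = weighted_form F G * mat_adjoint M"
proof -
  have "weighted_form F (mat_poly_const M * G) = mat_adjoint (weighted_form (mat_poly_const M * G) F)"
    using M F G by (intro weighted_form_adjoint[symmetric]) (auto simp: mat_algebra)
  also have "\<dots> = mat_adjoint (weighted_form G F) * mat_adjoint M"
    by (simp add: weighted_form_const_left[OF M G] mat_adjoint_mult[OF M weighted_form_carrier])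
  also have "mat_adjoint (weighted_form G F) = weighted_form F G" by (rule weighted_form_adjoint[OF G F])
  finally show ?thesis .
qed

text \<open>
  The diagonal entries of the form are sums of scalar integrals of \<open>|f|\<^sup>2\<close> with positive weights, so they
  force \<open>F e\<^sup>A\<^sup>x = 0\<close>; and \<open>e\<^sup>A\<^sup>x\<close> has determinant 1.
\<close>

lemma weighted_form_definite:
  assumes F: "F \<in> carrier_mat N N" and zero: "weighted_form F F = 0\<^sub>m N N"
  shows "F = 0\<^sub>m N N"
proof -
  have "F * U = 0\<^sub>m N N"
  proof (rule eq_matI)
    fix i j assume "i < dim_row (0\<^sub>m N N :: complex poly mat)" "j < dim_col (0\<^sub>m N N :: complex poly mat)"
    hence ij: "i < N" "j < N" by auto
    define f where "f = (\<lambda>k. (F * U) $$ (i, k))"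
    define t where "t = (\<lambda>k. \<delta> (k + 1) * Re (laguerre_integral (\<sigma> k) (f k * map_poly cnj (f k))))"
    have pos: "t k > 0" if "k < N" "f k \<noteq> 0" for k
      using laguerre_integral_norm_nonzero[OF sigma that(2), of k] delta[of "k + 1"] that(1) by (auto simp: t_def)
    hence nn: "t k \<ge> 0" if "k < N" for k
      using that by (cases "f k = 0") (auto simp: t_def intro: less_imp_le)
    have "Re (weighted_form F F $$ (i, i)) = (\<Sum>k<N. t k)"
      by (simp add: weighted_form_index ij t_def f_def del: index_mult_mat(1))
    hence "(\<Sum>k<N. t k) = 0" using zero ij by simp
    hence "t j = 0" using nn ij by (subst (asm) sum_nonneg_eq_0_iff) auto
    hence "f j = 0" using pos[OF ij(2)] by force
    thus "(F * U) $$ (i, j) = 0\<^sub>m N N $$ (i, j)" using ij by (simp add: f_def)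
  qed (use F in \<open>auto simp: exp_poly_def\<close>)
  hence "F * U * adj_mat U = 0\<^sub>m N N"
    using adj_mat(1)[of U N] by simp
  moreover have "F * U * adj_mat U = F"
    using F adj_mat[of U N] by (simp add: mat_algebra det_exp_poly)
  ultimately show ?thesis by simp
qed

section \<open>Three differential operators and their adjoints\<close>

text \<open>
  The three operators act on matrix polynomials from the right, so they commute with multiplication by
  constant matrices from the left. Their form is dictated by what they become under \<open>F \<mapsto> F e\<^sup>A\<^sup>x\<close>:
  column by column, with \<open>s = \<nu> + k\<close> in column \<open>k\<close>, they are the scalar operators \<open>x f' - x f\<close>,
  \<open>x f' + (s + 1) f\<close> and \<open>x f'' + (s + 1 - x) f' - k f\<close>. The last one is the classical Laguerre
  operator shifted by the constant \<open>k\<close>.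
\<close>

definition raising_op :: "complex poly mat \<Rightarrow> complex poly mat" where
  "raising_op F = mat_shift (mat_pderiv F + F * mat_poly_const (A - I))"

definition euler_op :: "complex poly mat \<Rightarrow> complex poly mat" where
  "euler_op F = mat_shift (mat_pderiv F) + F * mat_poly_const (complex_of_real (\<nu> + 1) \<cdot>\<^sub>m I + J)"

definition laguerre_op :: "complex poly mat \<Rightarrow> complex poly mat" where
  "laguerre_op F = mat_shift (mat_pderiv (mat_pderiv F))
     + mat_pderiv F * mat_poly_const (complex_of_real (\<nu> + 1) \<cdot>\<^sub>m I + J)
     + mat_shift (mat_pderiv F * mat_poly_const (A - I))
     + F * mat_poly_const (A * (complex_of_real (\<nu> + 1) \<cdot>\<^sub>m I + J) - J)"

lemma op_carrier [simp, intro]: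
  assumes "F \<in> carrier_mat N N"
  shows "raising_op F \<in> carrier_mat N N" "euler_op F \<in> carrier_mat N N" "laguerre_op F \<in> carrier_mat N N"
  using assms by (auto simp: raising_op_def euler_op_def laguerre_op_def mat_algebra)

lemma mat_pderiv_carrier [simp]: "F \<in> carrier_mat N N \<Longrightarrow> mat_pderiv F \<in> carrier_mat N N"
  by simp

lemma raising_op_conj:
  assumes F: "F \<in> carrier_mat N N"
  shows "raising_op F * U = mat_shift (mat_pderiv (F * U) - F * U)"
proof -
  have "raising_op F * U = mat_shift (mat_pderiv F * U + F * mat_pderiv U - F * U)"
    using F by (simp add: raising_op_def const_hom mat_algebra pderiv_exp_poly_left) 
       (intro eq_matI; simp add: algebra_simps del: index_mult_mat(1))
  thus ?thesis using F by (simp add: mat_pderiv_mult[of _ N N _ N])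
qed

lemma euler_op_conj:
  assumes F: "F \<in> carrier_mat N N"
  shows "euler_op F * U = mat_shift (mat_pderiv (F * U)) + [:of_real (\<nu> + 1):] \<cdot>\<^sub>m (F * U) + F * U * mat_poly_const J"
proof -
  note c = F mat_pderiv_carrier[OF F] mat_pderiv_carrier[of U]
  show ?thesis
    using c
    by (simp add: euler_op_def const_hom mat_algebra lag_J_exp_poly mat_pderiv_mult[of _ N N _ N])
       (intro eq_matI; simp add: algebra_simps del: index_mult_mat(1))
qed

text \<open>
  The terms with \<open>A\<close> cancel: those that come from differentiating \<open>e\<^sup>A\<^sup>x\<close> are compensated by the ones in
  the coefficients of the operator and by \<open>J e\<^sup>A\<^sup>x = e\<^sup>A\<^sup>x J + x (e\<^sup>A\<^sup>x)'\<close>.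
\<close>

lemma laguerre_op_conj:
  assumes F: "F \<in> carrier_mat N N"
  defines "G \<equiv> F * U"
  shows "laguerre_op F * U = mat_shift (mat_pderiv (mat_pderiv G)) + [:of_real (\<nu> + 1):] \<cdot>\<^sub>m mat_pderiv G
     + mat_pderiv G * mat_poly_const J - mat_shift (mat_pderiv G) - G * mat_poly_const J"
proof -
  define U1 where "U1 = mat_pderiv U"
  define U2 where "U2 = mat_pderiv U1"
  define F1 where "F1 = mat_pderiv F"
  define F2 where "F2 = mat_pderiv F1"
  have c [simp]: "F \<in> carrier_mat N N" "F1 \<in> carrier_mat N N" "F2 \<in> carrier_mat N N"
      "U1 \<in> carrier_mat N N" "U2 \<in> carrier_mat N N"
    using F by (simp_all add: F1_def F2_def U1_def U2_def)
  have AU: "mat_poly_const A * U = U1"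
    by (simp add: U1_def pderiv_exp_poly_left)
  have "mat_pderiv (mat_poly_const A) = 0\<^sub>m N N"
    by (intro eq_matI) (auto simp: mat_poly_const_def lag_A_def)
  hence AU1: "mat_poly_const A * U1 = U2"
    using mat_pderiv_mult[of "mat_poly_const A" N N U N] unfolding AU U2_def by (simp add: U1_def mat_algebra)
  have JU: "mat_poly_const J * U = U * mat_poly_const J + mat_shift U1"
    by (simp add: lag_J_exp_poly U1_def)
  have AUJ: "mat_poly_const A * (U * mat_poly_const J) = U1 * mat_poly_const J"
    using square_mat_distrib(5)[of "mat_poly_const A" N U "mat_poly_const J"] by (simp add: AU)
  have G1: "mat_pderiv G = F1 * U + F * U1"
    unfolding G_def by (subst mat_pderiv_mult[of _ N N _ N]) (auto simp: F1_def U1_def)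
  have add: "mat_pderiv (X + Y) = mat_pderiv X + mat_pderiv Y" if "X \<in> carrier_mat N N" "Y \<in> carrier_mat N N" for X Y
    using that by (intro eq_matI) (auto simp: pderiv_add)
  have G2: "mat_pderiv (mat_pderiv G) = F2 * U + F1 * U1 + (F1 * U1 + F * U2)"
    unfolding G1 by (simp add: add mat_algebra mat_pderiv_mult[of _ N N _ N] flip: F2_def F1_def U1_def U2_def)
  show ?thesis
    unfolding G2 unfolding G1 unfolding G_def laguerre_op_def
    using c[THEN carrier_matD(1)] c[THEN carrier_matD(2)]
    by (simp add: const_hom mat_algebra JU AU AU1 AUJ flip: F1_def F2_def)
       (intro eq_matI; simp add: algebra_simps del: index_mult_mat(1))
qed

text \<open>
  In a column this is the integration by parts of \<open>x f g\<^sup>* x\<^sup>s e\<^sup>-\<^sup>x\<close>.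
\<close>

lemma raising_op_adjoint:
  assumes F: "F \<in> carrier_mat N N" and G: "G \<in> carrier_mat N N"
  shows "weighted_form (raising_op F) G = - weighted_form F (euler_op G)"
proof (rule eq_matI)
  fix i j assume "i < dim_row (- weighted_form F (euler_op G))" "j < dim_col (- weighted_form F (euler_op G))"
  hence ij: "i < N" "j < N" by auto
  have FU: "F * U \<in> carrier_mat N N" "G * U \<in> carrier_mat N N" using F G by (auto simp: mat_algebra)
  have "laguerre_integral (\<sigma> k) ((raising_op F * U) $$ (i, k) * map_poly cnj ((G * U) $$ (j, k))) =
      - laguerre_integral (\<sigma> k) ((F * U) $$ (i, k) * map_poly cnj ((euler_op G * U) $$ (j, k)))" if k: "k < N" for k
  proof -
    define f g where "f = (F * U) $$ (i, k)" and "g = (G * U) $$ (j, k)"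
    have 1: "(raising_op F * U) $$ (i, k) = pCons 0 (pderiv f) - pCons 0 f"
      unfolding raising_op_conj[OF F] using F G FU ij k by (simp add: f_def del: index_mult_mat(1))
    have 2: "(euler_op G * U) $$ (j, k) = pCons 0 (pderiv g) + Polynomial.smult (of_real (\<nu> + 1)) g + Polynomial.smult (of_nat (k + 1)) g"
      unfolding euler_op_conj[OF G] using F G FU ij k by (simp add: g_def lag_J_mult_right del: index_mult_mat(1))
    show ?thesis
      unfolding 1 2 f_def[symmetric] g_def[symmetric]
      using laguerre_integral_by_parts[OF sigma, of k "f * map_poly cnj g"]
      by (simp add: map_poly_cnj_hom pderiv_mult laguerre_integral_pCons_0_linear[OF sigma] laguerre_integral_add[OF sigma] laguerre_integral_diff[OF sigma] laguerre_integral_smult sigma of_real_sigma algebra_simps)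
  qed
  thus "weighted_form (raising_op F) G $$ (i, j) = (- weighted_form F (euler_op G)) $$ (i, j)"
    using ij by (simp add: weighted_form_index sum_negf del: index_mult_mat(1))
qed auto

text \<open>
  Apart from the term \<open>- k f\<close>, which is symmetric, both sides are
  \<open>- \<integral> x f' g'\<^sup>* x\<^sup>s e\<^sup>-\<^sup>x\<close> in column \<open>k\<close>, by integration by parts of
  \<open>x f' g\<^sup>* x\<^sup>s e\<^sup>-\<^sup>x\<close> and of \<open>x f g'\<^sup>* x\<^sup>s e\<^sup>-\<^sup>x\<close>.
\<close>

lemma laguerre_op_symmetric:
  assumes F: "F \<in> carrier_mat N N" and G: "G \<in> carrier_mat N N"
  shows "weighted_form (laguerre_op F) G = weighted_form F (laguerre_op G)"
proof (rule eq_matI)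
  fix i j assume "i < dim_row (weighted_form F (laguerre_op G))" "j < dim_col (weighted_form F (laguerre_op G))"
  hence ij: "i < N" "j < N" by auto
  have FU: "F * U \<in> carrier_mat N N" "G * U \<in> carrier_mat N N" using F G by (auto simp: mat_algebra)
  have "laguerre_integral (\<sigma> k) ((laguerre_op F * U) $$ (i, k) * map_poly cnj ((G * U) $$ (j, k))) =
      laguerre_integral (\<sigma> k) ((F * U) $$ (i, k) * map_poly cnj ((laguerre_op G * U) $$ (j, k)))" if k: "k < N" for k
  proof -
    define f g where "f = (F * U) $$ (i, k)" and "g = (G * U) $$ (j, k)"
    let ?L = "\<lambda>f. pCons 0 (pderiv (pderiv f)) + Polynomial.smult (of_real (\<nu> + 1)) (pderiv f) + Polynomial.smult (of_nat (k + 1)) (pderiv f)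
       - pCons 0 (pderiv f) - Polynomial.smult (of_nat (k + 1)) f"
    have 1: "(laguerre_op F * U) $$ (i, k) = ?L f"
      unfolding laguerre_op_conj[OF F] using F G FU ij k by (simp add: f_def lag_J_mult_right del: index_mult_mat(1))
    have 2: "(laguerre_op G * U) $$ (j, k) = ?L g"
      unfolding laguerre_op_conj[OF G] using F G FU ij k by (simp add: g_def lag_J_mult_right del: index_mult_mat(1))
    show ?thesis
      unfolding 1 2 f_def[symmetric] g_def[symmetric]
      using arg_cong2[OF laguerre_integral_by_parts[OF sigma, of k "pderiv f * map_poly cnj g"]
        laguerre_integral_by_parts[OF sigma, of k "f * map_poly cnj (pderiv g)"], of "(-)"]
      by (simp add: map_poly_cnj_hom pderiv_mult laguerre_integral_pCons_0_linear[OF sigma] laguerre_integral_add[OF sigma] laguerre_integral_diff[OF sigma] laguerre_integral_smult sigma of_real_sigma algebra_simps)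
  qed
  thus "weighted_form (laguerre_op F) G $$ (i, j) = weighted_form F (laguerre_op G) $$ (i, j)"
    using ij by (simp add: weighted_form_index del: index_mult_mat(1))
qed auto

end

section \<open>Orthogonal polynomials\<close>

locale laguerre_orthogonal = laguerre_weight +
  fixes P :: "nat \<Rightarrow> complex poly mat" and H :: "nat \<Rightarrow> complex mat"
  assumes monic: "\<And>n. monic_mat_poly N n (P n)"
    and ortho: "\<And>n m. weighted_form (P n) (P m) = (if n = m then H n else 0\<^sub>m N N)"
begin

lemma P_carrier [simp, intro]: "P n \<in> carrier_mat N N"
  by (rule monic_mat_poly_coeff(1)[OF monic])

lemma P_lead: "mat_coeff (P n) n = I" and P_above: "k > n \<Longrightarrow> mat_coeff (P n) k = 0\<^sub>m N N"
  using monic_mat_poly_coeff[OF monic] by auto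

lemma H_carrier [simp, intro]: "H n \<in> carrier_mat N N"
  using ortho[of n n] weighted_form_carrier[of "P n" "P n"] by simp

lemma H_selfadjoint: "mat_adjoint (H n) = H n"
  using weighted_form_adjoint[of "P n" "P n"] ortho[of n n] by simp

text \<open>
  If \<open>H n v = 0\<close>, then the matrix \<open>M\<close> all of whose rows are \<open>v\<^sup>*\<close> makes the pairing of
  \<open>M P\<^sub>n\<close> with itself vanish. So \<open>M P\<^sub>n = 0\<close> by definiteness, and the leading coefficient of \<open>M P\<^sub>n\<close> is \<open>M\<close>.
\<close>

lemma det_H_nonzero: "det (H n) \<noteq> 0"
proof
  assume "det (H n) = 0"
  then obtain v where v: "v \<in> carrier_vec N" "v \<noteq> 0\<^sub>v N" "H n *\<^sub>v v = 0\<^sub>v N"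
    using det_0_iff_vec_prod_zero[OF H_carrier] by auto
  define M where "M = Matrix.mat N N (\<lambda>(i, j). cnj (v $ j))"
  have M: "M \<in> carrier_mat N N" by (simp add: M_def)
  have "H n * mat_adjoint M = 0\<^sub>m N N"
  proof (rule eq_matI)
    fix i j assume "i < dim_row (0\<^sub>m N N :: complex mat)" "j < dim_col (0\<^sub>m N N :: complex mat)"
    hence ij: "i < N" "j < N" by auto
    have "(H n *\<^sub>v v) $ i = 0" using v(3) ij by simp
    moreover have "col (mat_adjoint M) j = v"
      using v(1) ij M by (intro eq_vecI) (auto simp: M_def)
    ultimately show "(H n * mat_adjoint M) $$ (i, j) = 0\<^sub>m N N $$ (i, j)"
      using ij carrier_matD[OF M] carrier_matD[OF H_carrier[of n]] by simp
  qed (use carrier_matD[OF M] carrier_matD[OF H_carrier[of n]] in auto)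
  moreover have "weighted_form (mat_poly_const M * P n) (mat_poly_const M * P n) = M * (H n * mat_adjoint M)"
    using M by (simp add: weighted_form_const_left weighted_form_const_right ortho mat_algebra)
  ultimately have "mat_poly_const M * P n = 0\<^sub>m N N"
    using M by (intro weighted_form_definite) (auto simp: mat_algebra)
  hence "mat_coeff (mat_poly_const M * P n) n = 0\<^sub>m N N"
    by (auto simp: mat_coeff_def intro!: eq_matI)
  hence "M = 0\<^sub>m N N" using M by (simp add: mat_coeff_const_mult[of _ N N _ N] P_lead mat_algebra)
  moreover obtain j where j: "j < N" "v $ j \<noteq> 0"
    using v(1,2) by (metis carrier_vecD eq_vecI index_zero_vec(1) index_zero_vec(2))
  ultimately have "M $$ (j, j) = 0" by simp
  thus False using j by (simp add: M_def)
qed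

abbreviation "K n \<equiv> mat_inv (H n)"

lemma K_carrier [simp, intro]: "K n \<in> carrier_mat N N"
  and H_K: "H n * K n = I" and K_H: "K n * H n = I"
  using mat_inv_inverts[OF H_carrier det_H_nonzero] by auto

lemma low_degree_orthogonal:
  assumes "F \<in> carrier_mat N N" "m \<le> n" "\<And>k. k \<ge> m \<Longrightarrow> mat_coeff F k = 0\<^sub>m N N"
  shows "weighted_form F (P n) = 0\<^sub>m N N"
  using assms
proof (induction m arbitrary: F)
  case 0
  hence "F = 0\<^sub>m N N"
    by (intro mat_poly_eqI[of _ N N]) (auto simp: mat_coeff_def intro!: eq_matI)
  hence "F = mat_poly_const (0\<^sub>m N N) * F" by (auto simp: mat_poly_const_def intro!: eq_matI)
  hence "weighted_form F (P n) = 0\<^sub>m N N * weighted_form F (P n)"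
    using weighted_form_const_left[of "0\<^sub>m N N" F] 0 by simp
  thus ?case by (simp add: mat_algebra)
next
  case (Suc m)
  let ?L = "mat_coeff F m"
  define R where "R = F - mat_poly_const ?L * P m"
  have R: "R \<in> carrier_mat N N" using Suc.prems by (simp add: R_def mat_algebra)
  have "weighted_form R (P n) = 0\<^sub>m N N"
  proof (rule Suc.IH[OF R])
    fix k assume k: "m \<le> k"
    have "mat_coeff R k = mat_coeff F k - ?L * mat_coeff (P m) k"
      using Suc.prems by (simp add: R_def mat_coeff_minus[of _ N N] mat_coeff_const_mult[of _ N N _ N] mat_algebra)
    thus "mat_coeff R k = 0\<^sub>m N N"
      using k Suc.prems by (cases "k = m") (auto simp: P_lead P_above mat_algebra)
  qed (use Suc.prems in simp)
  moreover have "weighted_form R (P n) = weighted_form F (P n) - ?L * weighted_form (P m) (P n)"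
    using Suc.prems by (simp add: R_def weighted_form_minus_left weighted_form_const_left mat_algebra)
  moreover have "weighted_form (P m) (P n) = 0\<^sub>m N N" using ortho Suc.prems by simp
  ultimately show ?case using Suc.prems(1)
    by (simp add: mat_algebra)
qed

text \<open>
  The pairing of \<open>F\<close> with \<open>P\<^sub>m\<close> reads off the coefficient of \<open>x\<^sup>m\<close> in \<open>F\<close>, provided that the higher ones
  vanish. All relations below are obtained by evaluating a pairing in this way twice, before and after
  moving an operator to the other side.
\<close>

lemma weighted_form_P_right:
  assumes F: "F \<in> carrier_mat N N" and above: "\<And>k. k > m \<Longrightarrow> mat_coeff F k = 0\<^sub>m N N"
  shows "weighted_form F (P m) = mat_coeff F m * H m"
proof -
  let ?L = "mat_coeff F m"
  define R where "R = F - mat_poly_const ?L * P m"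
  have R: "R \<in> carrier_mat N N" using F by (simp add: R_def mat_algebra)
  have "weighted_form R (P m) = 0\<^sub>m N N"
  proof (rule low_degree_orthogonal[OF R order.refl])
    fix k assume k: "m \<le> k"
    have "mat_coeff R k = mat_coeff F k - ?L * mat_coeff (P m) k"
      using F by (simp add: R_def mat_coeff_minus[of _ N N] mat_coeff_const_mult[of _ N N _ N] mat_algebra)
    thus "mat_coeff R k = 0\<^sub>m N N"
      using k F above by (cases "k = m") (auto simp: P_lead P_above mat_algebra)
  qed
  moreover have "weighted_form R (P m) = weighted_form F (P m) - ?L * H m"
    using F by (simp add: R_def weighted_form_minus_left weighted_form_const_left mat_algebra ortho)
  ultimately have "weighted_form F (P m) - ?L * H m = 0\<^sub>m N N" by simp
  thus ?thesis using F
    by (subst (asm) square_mat_minus_eq_0_iff) (auto simp: mat_algebra)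
qed

section \<open>Coefficients of the orthogonal polynomials\<close>

text \<open>
  The coefficients of \<open>x\<^sup>n\<^sup>-\<^sup>1\<close> and of \<open>x\<^sup>n\<^sup>-\<^sup>2\<close> in \<open>P\<^sub>n\<close>. Shifting the polynomial rather than the index makes
  them zero when the exponent would be negative.
\<close>

definition "subleading n = mat_coeff (mat_shift (P n)) n"
definition "subsubleading n = mat_coeff (mat_shift (mat_shift (P n))) n"

lemma subleading_carrier [simp, intro]: "subleading n \<in> carrier_mat N N" "subsubleading n \<in> carrier_mat N N"
  by (auto simp: subleading_def subsubleading_def)

lemma coefficient_dim [simp]:
  "dim_row (subleading n) = N" "dim_col (subleading n) = N" "dim_row (subsubleading n) = N" "dim_col (subsubleading n) = N"
  "dim_row (H n) = N" "dim_col (H n) = N" "dim_row (K n) = N" "dim_col (K n) = N"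
  using carrier_matD[OF subleading_carrier(1)[of n]] carrier_matD[OF subleading_carrier(2)[of n]]
    carrier_matD[OF H_carrier[of n]] carrier_matD[OF K_carrier[of n]] by simp_all

lemma mat_coeff_shift_mult_const:
  assumes "F \<in> carrier_mat N N" "M \<in> carrier_mat N N"
  shows "mat_coeff (mat_shift (F * mat_poly_const M)) k = mat_coeff (mat_shift F) k * M"
proof -
  have "mat_shift (F * mat_poly_const M) = mat_shift F * mat_poly_const M" using assms by (simp add: mat_algebra)
  thus ?thesis using assms by (simp add: mat_coeff_mult_const[of _ N N _ N] square_mat_closed[where N = N])
qed

lemma mat_coeff_raise:
  assumes "F \<in> carrier_mat N N"
  shows "mat_coeff (raising_op F) k = of_nat k \<cdot>\<^sub>m mat_coeff F k + mat_coeff (mat_shift F) k * (A - I)"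
proof -
  have "raising_op F = mat_shift (mat_pderiv F) + mat_shift (F * mat_poly_const (A - I))"
    unfolding raising_op_def using assms
    by (intro add_smult_distrib_left_mat[of _ N N]) (auto simp: mat_algebra)
  thus ?thesis using assms
    by (simp add: mat_coeff_add[of _ N N] mat_coeff_shift_pderiv mat_coeff_shift_mult_const square_mat_closed[where N = N])
qed

lemma mat_coeff_euler:
  assumes "F \<in> carrier_mat N N"
  shows "mat_coeff (euler_op F) k = of_nat k \<cdot>\<^sub>m mat_coeff F k + mat_coeff F k * (of_real (\<nu> + 1) \<cdot>\<^sub>m I + J)"
  unfolding euler_op_def using assms
  by (simp add: mat_coeff_add[of _ N N] mat_coeff_shift_pderiv mat_coeff_mult_const[of _ N N _ N] square_mat_closed[where N = N])

lemma mat_coeff_laguerre: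
  assumes "F \<in> carrier_mat N N"
  shows "mat_coeff (laguerre_op F) k =
      of_nat k \<cdot>\<^sub>m (of_nat (Suc k) \<cdot>\<^sub>m mat_coeff F (Suc k))
    + (of_nat (Suc k) \<cdot>\<^sub>m mat_coeff F (Suc k)) * (of_real (\<nu> + 1) \<cdot>\<^sub>m I + J)
    + (of_nat k \<cdot>\<^sub>m mat_coeff F k) * (A - I)
    + mat_coeff F k * (A * (of_real (\<nu> + 1) \<cdot>\<^sub>m I + J) - J)"
  unfolding laguerre_op_def using assms
  by (simp add: mat_coeff_add[of _ N N] mat_coeff_shift_pderiv mat_coeff_pderiv mat_coeff_shift_mult_const
    mat_coeff_mult_const[of _ N N _ N] square_mat_closed[where N = N] del: of_nat_Suc)

text \<open>
  \<open>Y n\<close> is the coefficient of \<open>P\<^sub>n\<^sub>-\<^sub>1\<close> in the image of \<open>P\<^sub>n\<close> under the Euler operator, up to sign.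
  All seven identities are relations between \<open>B\<close>, \<open>C\<close>, \<open>\<Gamma>\<close>, \<open>Y\<close>, \<open>h\<close> and the constant
  matrices \<open>A\<close> and \<open>J\<close>.
\<close>

definition "\<Gamma> n = A * (of_real (real n + \<nu> + 1) \<cdot>\<^sub>m I + J) - of_nat n \<cdot>\<^sub>m I - J"
definition "Y n = H n * mat_adjoint (A - I) * K (n - 1)"
definition "h n = H n * J * K n"

lemma Gamma_Y_h_carrier [simp, intro]: "\<Gamma> n \<in> carrier_mat N N" "Y n \<in> carrier_mat N N" "h n \<in> carrier_mat N N"
  by (auto simp: \<Gamma>_def Y_def h_def mat_algebra)

lemma Gamma_Y_h_dim [simp]:
  "dim_row (\<Gamma> n) = N" "dim_col (\<Gamma> n) = N" "dim_row (Y n) = N" "dim_col (Y n) = N"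
  "dim_row (h n) = N" "dim_col (h n) = N"
  using carrier_matD[OF Gamma_Y_h_carrier(1)[of n]] carrier_matD[OF Gamma_Y_h_carrier(2)[of n]]
    carrier_matD[OF Gamma_Y_h_carrier(3)[of n]] by simp_all

lemma adjoint_J: "mat_adjoint J = J"
  by (intro eq_matI) (auto simp: lag_J_def)

lemma adjoint_A_minus_I: "mat_adjoint (A - I) = transpose_mat A - I"
  by (intro eq_matI) (auto simp: lag_A_def)

lemma adjoint_scalar_J: "mat_adjoint (of_real r \<cdot>\<^sub>m I + J) = of_real r \<cdot>\<^sub>m I + J"
  by (intro eq_matI) (auto simp: lag_J_def)

lemma J_A: "J * A = A * J + A"
proof (rule eq_matI)
  fix i j assume "i < dim_row (A * J + A)" "j < dim_col (A * J + A)"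
  hence ij: "i < N" "j < N" by auto
  have "(J * A) $$ (i, j) = (\<Sum>k<N. (if k = i then of_nat (i + 1) else 0) * A $$ (k, j))"
    using ij by (subst index_mult_mat_sum[of _ N N _ N]) (auto simp: lag_J_def intro!: sum.cong)
  also have "\<dots> = (\<Sum>k<N. if k = i then of_nat (i + 1) * A $$ (i, j) else 0)"
    by (intro sum.cong) auto
  finally have JA: "(J * A) $$ (i, j) = of_nat (i + 1) * A $$ (i, j)" using ij by simp
  have "(A * J) $$ (i, j) = (\<Sum>k<N. A $$ (i, k) * (if k = j then of_nat (j + 1) else 0))"
    using ij by (subst index_mult_mat_sum[of _ N N _ N]) (auto simp: lag_J_def intro!: sum.cong)
  also have "\<dots> = (\<Sum>k<N. if k = j then A $$ (i, j) * of_nat (j + 1) else 0)"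
    by (intro sum.cong) auto
  finally have AJ: "(A * J) $$ (i, j) = A $$ (i, j) * of_nat (j + 1)" using ij by simp
  show "(J * A) $$ (i, j) = (A * J + A) $$ (i, j)"
    using ij JA AJ by (auto simp: lag_A_def algebra_simps simp del: index_mult_mat(1))
qed auto

lemma J_A_mult:
  assumes X: "X \<in> carrier_mat N N"
  shows "J * (A * X) = A * (J * X) + A * X"
proof -
  have "J * (A * X) = (J * A) * X" using X by (intro square_mat_distrib(5)[symmetric]) auto
  also have "\<dots> = A * (J * X) + A * X" using X by (simp only: J_A) (simp add: mat_algebra)
  finally show ?thesis .
qed

lemma coeff_P_Suc: "mat_coeff (P (Suc n)) n = subleading (Suc n)"
  by (simp add: subleading_def mat_coeff_shift_Suc)

lemma coeff_P_Suc_Suc: "mat_coeff (P (Suc (Suc n))) n = subsubleading (Suc (Suc n))"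
  by (simp add: subsubleading_def mat_coeff_shift_Suc)

lemma mat_coeff_shift_P:
  "mat_coeff (mat_shift (P n)) (Suc n) = I" "k > Suc n \<Longrightarrow> mat_coeff (mat_shift (P n)) k = 0\<^sub>m N N"
  by (cases k; simp add: mat_coeff_shift_Suc P_lead P_above)+

text \<open>
  \<open>\<Gamma> n\<close> is the coefficient of \<open>x\<^sup>n\<close> in the image of \<open>P\<^sub>n\<close> under the Laguerre operator, and this operator is
  symmetric.
\<close>

lemma Gamma_H: "\<Gamma> n * H n = H n * mat_adjoint (\<Gamma> n)"
proof -
  have above: "mat_coeff (laguerre_op (P n)) k = 0\<^sub>m N N" if "k > n" for k
    using that by (simp add: mat_coeff_laguerre P_above mat_algebra del: of_nat_Suc)
  have lead: "mat_coeff (laguerre_op (P n)) n = \<Gamma> n"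
    unfolding mat_coeff_laguerre[OF P_carrier] P_lead P_above[OF lessI] \<Gamma>_def
    by (simp add: mat_algebra del: of_nat_Suc)
       (intro eq_matI; simp add: algebra_simps del: index_mult_mat(1) index_one_mat(1))
  have "\<Gamma> n * H n = weighted_form (laguerre_op (P n)) (P n)"
    using weighted_form_P_right[OF _ above] lead by (simp add: op_carrier)
  moreover from this have "mat_adjoint (\<Gamma> n * H n) = weighted_form (P n) (laguerre_op (P n))"
    by (simp add: weighted_form_adjoint op_carrier)
  ultimately have "\<Gamma> n * H n = mat_adjoint (\<Gamma> n * H n)"
    by (simp add: laguerre_op_symmetric)
  thus ?thesis by (simp add: mat_adjoint_mult[of _ N N _ N] H_selfadjoint)
qed

lemma weighted_form_euler: "weighted_form (euler_op (P n)) (P m) = - mat_adjoint (weighted_form (raising_op (P m)) (P n))"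
proof -
  have "weighted_form (euler_op (P n)) (P m) = mat_adjoint (weighted_form (P m) (euler_op (P n)))"
    by (simp add: weighted_form_adjoint op_carrier)
  also have "weighted_form (P m) (euler_op (P n)) = - weighted_form (raising_op (P m)) (P n)"
    by (simp add: raising_op_adjoint)
  finally show ?thesis by (auto intro!: eq_matI)
qed

text \<open>
  Apply the raising operator to \<open>P\<^sub>n\<close>, subtract \<open>(A - 1) P\<^sub>n\<^sub>+\<^sub>1\<close> to remove the term of degree \<open>n + 1\<close>, and pair
  with \<open>P\<^sub>n\<close>. On the other side stands the Euler operator, which preserves the degree and contributes
  \<open>-H\<^sub>n (n + \<nu> + 1 + J)\<close>.
\<close>

lemma h_eq: "h n = (A - I) * subleading (Suc n) - subleading n * (A - I) - of_real (2 * real n + \<nu> + 1) \<cdot>\<^sub>m I"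
proof -
  define L where "L = of_nat n \<cdot>\<^sub>m I + subleading n * (A - I) - (A - I) * subleading (Suc n)"
  define T where "T = of_real (real n + \<nu> + 1) \<cdot>\<^sub>m I + J"
  have T: "T \<in> carrier_mat N N" by (simp add: T_def mat_algebra)
  have adjT: "mat_adjoint T = T" unfolding T_def by (rule adjoint_scalar_J)
  define R where "R = raising_op (P n) - mat_poly_const (A - I) * P (Suc n)"
  have L: "L \<in> carrier_mat N N" by (auto simp: L_def mat_algebra)
  have R: "R \<in> carrier_mat N N" by (auto simp: R_def mat_algebra)
  have coeff_R: "mat_coeff R k = of_nat k \<cdot>\<^sub>m mat_coeff (P n) k + mat_coeff (mat_shift (P n)) k * (A - I)
      - (A - I) * mat_coeff (P (Suc n)) k" for k
    by (simp add: R_def mat_coeff_minus[of _ N N] mat_coeff_raise mat_coeff_const_mult[of _ N N _ N] op_carrier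
       square_mat_closed[where N = N])
  have "mat_coeff R k = 0\<^sub>m N N" if "k > n" for k
    using that unfolding coeff_R
    by (cases "k = Suc n") (simp_all add: P_lead P_above mat_coeff_shift_P mat_algebra)
  hence "weighted_form R (P n) = mat_coeff R n * H n" by (intro weighted_form_P_right R)
  also have "mat_coeff R n = L"
    unfolding coeff_R L_def by (simp add: P_lead coeff_P_Suc subleading_def)
  finally have "L * H n = weighted_form (raising_op (P n)) (P n) - (A - I) * weighted_form (P (Suc n)) (P n)"
    by (simp add: R_def weighted_form_minus_left weighted_form_const_left op_carrier square_mat_closed[where N = N])
  hence 1: "L * H n = weighted_form (raising_op (P n)) (P n)"
    by (simp add: ortho mat_algebra)
  have "weighted_form (euler_op (P n)) (P n) = mat_coeff (euler_op (P n)) n * H n"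
    by (rule weighted_form_P_right) (auto simp: mat_coeff_euler P_above mat_algebra op_carrier)
  also have "mat_coeff (euler_op (P n)) n = T"
    by (simp add: T_def mat_coeff_euler P_lead mat_algebra)
       (intro eq_matI; simp add: algebra_simps del: index_one_mat(1))
  finally have "- mat_adjoint (L * H n) = T * H n"
    unfolding weighted_form_euler 1 .
  hence "mat_adjoint (- mat_adjoint (L * H n)) = H n * T"
    by (simp add: mat_adjoint_mult[of _ N N _ N] H_selfadjoint T adjT)
  also have "mat_adjoint (- mat_adjoint (L * H n)) = - (L * H n)"
    using L by (auto intro!: eq_matI simp del: index_mult_mat(1))
  finally have "- (L * H n) * K n = H n * T * K n" by simp
  hence "- L = of_real (real n + \<nu> + 1) \<cdot>\<^sub>m I + h n"
    using L T by (simp add: mat_algebra H_K h_def T_def)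
  hence "h n = - L - of_real (real n + \<nu> + 1) \<cdot>\<^sub>m I"
    using L by (auto simp: mat_eq_iff)
  thus ?thesis
    unfolding L_def by (simp add: mat_algebra)
      (intro eq_matI; simp add: algebra_simps del: index_mult_mat(1) index_one_mat(1))
qed

lemma coeff_raise_P:
  "mat_coeff (raising_op (P m)) (Suc m) = A - I"
  "k > Suc m \<Longrightarrow> mat_coeff (raising_op (P m)) k = 0\<^sub>m N N"
  by (simp_all add: mat_coeff_raise P_above mat_coeff_shift_P mat_algebra)

text \<open>
  The Euler operator applied to \<open>P\<^sub>n\<close> (here \<open>n = m + 1\<close>), with its leading term removed, is paired with
  \<open>P\<^sub>n\<^sub>-\<^sub>1\<close>. On the other side the raising operator takes \<open>P\<^sub>n\<^sub>-\<^sub>1\<close> to degree \<open>n\<close> with leading coefficient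
  \<open>A - 1\<close>.
\<close>

lemma Y_eq: "Y (Suc m) = subleading (Suc m) + J * subleading (Suc m) - subleading (Suc m) * J"
proof -
  let ?s = "subleading (Suc m)"
  let ?T = "of_real (real (Suc m) + \<nu> + 1) \<cdot>\<^sub>m I + J"
  define R where "R = euler_op (P (Suc m)) - mat_poly_const ?T * P (Suc m)"
  have R: "R \<in> carrier_mat N N" by (auto simp: R_def mat_algebra)
  have coeff_R: "mat_coeff R k = of_nat k \<cdot>\<^sub>m mat_coeff (P (Suc m)) k
     + mat_coeff (P (Suc m)) k * (of_real (\<nu> + 1) \<cdot>\<^sub>m I + J) - ?T * mat_coeff (P (Suc m)) k" for k
    by (simp add: R_def mat_coeff_minus[of _ N N] mat_coeff_euler mat_coeff_const_mult[of _ N N _ N] op_carrier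
       square_mat_closed[where N = N])
  have "mat_coeff R k = 0\<^sub>m N N" if "k > m" for k
  proof (cases "k = Suc m")
    case True
    show ?thesis unfolding coeff_R True P_lead
      by (simp add: mat_algebra) (intro eq_matI; simp add: algebra_simps del: index_one_mat(1))
  qed (use that in \<open>simp add: coeff_R P_above mat_algebra\<close>)
  hence "weighted_form R (P m) = mat_coeff R m * H m" by (intro weighted_form_P_right R)
  also have "mat_coeff R m = ?s * J - J * ?s - ?s"
    unfolding coeff_R coeff_P_Suc
    by (simp add: mat_algebra) (intro eq_matI; simp add: algebra_simps del: index_mult_mat(1) index_one_mat(1))
  also have "weighted_form R (P m) = weighted_form (euler_op (P (Suc m))) (P m)"
    by (simp add: R_def weighted_form_minus_left weighted_form_const_left op_carrier ortho square_mat_closed[where N = N] square_mat_one[where N = N])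
  also have "\<dots> = - mat_adjoint ((A - I) * H (Suc m))"
    unfolding weighted_form_euler
    by (subst weighted_form_P_right) (simp_all add: coeff_raise_P op_carrier)
  also have "\<dots> = - (H (Suc m) * mat_adjoint (A - I))"
    by (simp add: mat_adjoint_mult[of _ N N _ N] H_selfadjoint square_mat_closed[where N = N])
  finally have "- (H (Suc m) * mat_adjoint (A - I)) * K m = (?s * J - J * ?s - ?s) * H m * K m" by simp
  hence "- Y (Suc m) = ?s * J - J * ?s - ?s"
    by (simp add: Y_def mat_algebra H_K)
  hence "- (- Y (Suc m)) = - (?s * J - J * ?s - ?s)" by simp
  thus ?thesis by (simp) (intro eq_matI; simp add: algebra_simps del: index_mult_mat(1))
qed

text \<open>
  One degree further down, the pairing of the Euler image of \<open>P\<^sub>n\<close> with \<open>P\<^sub>n\<^sub>-\<^sub>2\<close> vanishes, because the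
  raising operator takes \<open>P\<^sub>n\<^sub>-\<^sub>2\<close> only to degree \<open>n - 1\<close>.
\<close>

lemma subsubleading_eq: "2 \<cdot>\<^sub>m subsubleading (Suc n) + J * subsubleading (Suc n) - subsubleading (Suc n) * J = Y (Suc n) * subleading n"
proof (cases n)
  case 0
  have "mat_shift (P 1) \<in> carrier_mat N N" "P 0 \<in> carrier_mat N N" by (auto simp: mat_algebra)
  hence "subsubleading (Suc 0) = 0\<^sub>m N N" "subleading 0 = 0\<^sub>m N N"
    by (simp_all add: subsubleading_def subleading_def mat_coeff_shift_Suc mat_coeff_shift_0[of _ N N])
  thus ?thesis using 0 by (simp add: mat_algebra) 
next
  case (Suc m)
  let ?q = "subsubleading (Suc (Suc m))" and ?s = "subleading (Suc m)" and ?s' = "subleading (Suc (Suc m))"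
  let ?T = "of_real (real (Suc (Suc m)) + \<nu> + 1) \<cdot>\<^sub>m I + J"
  \<comment> \<open>Subtracting \<open>- Y P\<close> removes the coefficient of degree \<open>m + 1\<close> that the Euler operator leaves.\<close>
  define R where "R = euler_op (P (Suc (Suc m))) - mat_poly_const ?T * P (Suc (Suc m)) - mat_poly_const (- Y (Suc (Suc m))) * P (Suc m)"
  have R: "R \<in> carrier_mat N N" by (auto simp: R_def mat_algebra)
  have coeff_R: "mat_coeff R k = of_nat k \<cdot>\<^sub>m mat_coeff (P (Suc (Suc m))) k
     + mat_coeff (P (Suc (Suc m))) k * (of_real (\<nu> + 1) \<cdot>\<^sub>m I + J) - ?T * mat_coeff (P (Suc (Suc m))) k
     - (- Y (Suc (Suc m))) * mat_coeff (P (Suc m)) k" for k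
    by (simp add: R_def mat_coeff_minus[of _ N N] mat_coeff_euler mat_coeff_const_mult[of _ N N _ N] op_carrier
       square_mat_closed[where N = N])
  have "mat_coeff R k = 0\<^sub>m N N" if k: "k > m" for k
  proof -
    consider "k = Suc m" | "k = Suc (Suc m)" | "k > Suc (Suc m)" using k by linarith
    thus ?thesis
    proof cases
      case 1
      show ?thesis unfolding coeff_R 1 P_lead coeff_P_Suc Y_eq
        by (simp add: mat_algebra) (intro eq_matI; simp add: algebra_simps del: index_mult_mat(1) index_one_mat(1))
    next
      case 2
      show ?thesis unfolding coeff_R 2 P_lead P_above[OF lessI]
        by (simp add: mat_algebra) (intro eq_matI; simp add: algebra_simps del: index_mult_mat(1) index_one_mat(1))
    next
      case 3
      thus ?thesis by (simp add: coeff_R P_above mat_algebra)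
    qed
  qed
  hence "weighted_form R (P m) = mat_coeff R m * H m" by (intro weighted_form_P_right R)
  also have "weighted_form R (P m) = weighted_form (euler_op (P (Suc (Suc m)))) (P m)"
    by (simp add: R_def weighted_form_minus_left weighted_form_const_left op_carrier ortho square_mat_closed[where N = N] square_mat_one[where N = N])
  also have "\<dots> = - mat_adjoint (0\<^sub>m N N)"
    unfolding weighted_form_euler
    by (subst low_degree_orthogonal[of _ "Suc (Suc m)"]) (simp_all add: coeff_raise_P op_carrier)
  also have "\<dots> = 0\<^sub>m N N" by (auto intro!: eq_matI)
  finally have "mat_coeff R m * H m * K m = 0\<^sub>m N N * K m" by simp
  hence "mat_coeff R m = 0\<^sub>m N N"
    using R by (simp add: mat_algebra H_K)
  moreover have "mat_coeff R m = Y (Suc (Suc m)) * ?s - (2 \<cdot>\<^sub>m ?q + J * ?q - ?q * J)"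
    unfolding coeff_R coeff_P_Suc coeff_P_Suc_Suc
    by (simp add: mat_algebra) (intro eq_matI; simp add: algebra_simps del: index_mult_mat(1) index_one_mat(1))
  ultimately show ?thesis
    unfolding Suc by (simp add: square_mat_minus_eq_0_iff[where N = N] square_mat_closed[where N = N])
qed

section \<open>Identities for the eigenvalue\<close>

definition "C n = H n * K (n - 1)"

lemma C_carrier [simp, intro]: "C n \<in> carrier_mat N N"
  and C_dim [simp]: "dim_row (C n) = N" "dim_col (C n) = N"
  by (auto simp: C_def mat_algebra)

lemma Gamma_Suc: "\<Gamma> (Suc n) = \<Gamma> n + (A - I)"
  unfolding \<Gamma>_def by (simp add: mat_algebra)
    (intro eq_matI; simp add: algebra_simps del: index_mult_mat(1) index_one_mat(1))

lemma Gamma_J: "J * \<Gamma> n - \<Gamma> n * J = of_nat n \<cdot>\<^sub>m I + \<Gamma> n + J"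
  unfolding \<Gamma>_def by (simp add: mat_algebra J_A J_A_mult)
    (intro eq_matI; simp add: algebra_simps del: index_mult_mat(1) index_one_mat(1))

lemma Gamma_A: "(A - I) * \<Gamma> (Suc n) - \<Gamma> n * (A - I) = - (A - I)"
  unfolding \<Gamma>_def by (simp add: mat_algebra J_A J_A_mult)
    (intro eq_matI; simp add: algebra_simps del: index_mult_mat(1) index_one_mat(1))

text \<open>
  Once \<open>\<Gamma>\<close> is moved across \<open>H\<close> and its inverse, where it becomes its adjoint, the identities that involve
  \<open>\<Gamma>\<close> reduce to the commutation relations of \<open>\<Gamma>\<close> with \<open>J\<close> and \<open>A - 1\<close>, hence to \<open>[J, A] = A\<close>.
\<close>

lemma H_adjoint_Gamma: "X \<in> carrier_mat N N \<Longrightarrow> \<Gamma> n * (H n * X) = H n * (mat_adjoint (\<Gamma> n) * X)"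
  by (simp add: Gamma_H square_mat_distrib(5)[of _ N, symmetric] del: assoc_mult_mat)

lemma K_Gamma: "K n * \<Gamma> n = mat_adjoint (\<Gamma> n) * K n"
proof -
  have "K n * (\<Gamma> n * H n) * K n = K n * (H n * mat_adjoint (\<Gamma> n)) * K n"
    by (simp only: Gamma_H)
  also have "K n * (\<Gamma> n * H n) * K n = K n * \<Gamma> n * (H n * K n)"
    by (simp add: mat_algebra)
  also have "K n * (H n * mat_adjoint (\<Gamma> n)) * K n = K n * H n * mat_adjoint (\<Gamma> n) * K n"
    by (simp add: mat_algebra)
  finally show ?thesis by (simp add: H_K K_H mat_algebra)
qed

lemma Gamma_C_relation: "\<Gamma> (Suc n) * C (Suc n) - C (Suc n) * \<Gamma> n = Y (Suc n)"
proof -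
  have "\<Gamma> (Suc n) * C (Suc n) - C (Suc n) * \<Gamma> n =
      H (Suc n) * ((mat_adjoint (\<Gamma> (Suc n)) - mat_adjoint (\<Gamma> n)) * K n)"
    by (simp add: C_def mat_algebra H_adjoint_Gamma K_Gamma)
  also have "mat_adjoint (\<Gamma> (Suc n)) - mat_adjoint (\<Gamma> n) = mat_adjoint (A - I)"
    unfolding Gamma_Suc by (auto intro!: eq_matI)
  finally show ?thesis by (simp add: Y_def mat_algebra)
qed

lemma Gamma_h_commutator: "\<Gamma> n * h n - h n * \<Gamma> n = of_nat n \<cdot>\<^sub>m I + \<Gamma> n + h n"
proof -
  let ?G = "mat_adjoint (\<Gamma> n)"
  have "\<Gamma> n * h n - h n * \<Gamma> n = H n * ((?G * J - J * ?G) * K n)"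
    by (simp add: h_def mat_algebra H_adjoint_Gamma K_Gamma)
  also have "?G * J - J * ?G = mat_adjoint (J * \<Gamma> n - \<Gamma> n * J)"
    by (simp add: mat_adjoint_minus[of _ N N] mat_adjoint_mult[of _ N N _ N] adjoint_J mat_algebra)
  also have "\<dots> = of_nat n \<cdot>\<^sub>m I + ?G + J"
    unfolding Gamma_J by (intro eq_matI) (auto simp: lag_J_def)
  also have "H n * ((of_nat n \<cdot>\<^sub>m I + ?G + J) * K n) = of_nat n \<cdot>\<^sub>m (H n * K n) + H n * (?G * K n) + h n"
    by (simp add: h_def mat_algebra)
  also have "H n * (?G * K n) = \<Gamma> n"
    by (simp add: H_adjoint_Gamma[symmetric] H_K mat_algebra)
  finally show ?thesis by (simp add: H_K)
qed

lemma Gamma_Y_relation: "\<Gamma> (Suc n) * Y (Suc n) - Y (Suc n) * \<Gamma> n = - Y (Suc n)"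
proof -
  let ?G = "\<lambda>n. mat_adjoint (\<Gamma> n)" and ?L = "mat_adjoint (A - I)"
  have L: "?L \<in> carrier_mat N N" by (auto simp: mat_algebra)
  have "\<Gamma> (Suc n) * Y (Suc n) - Y (Suc n) * \<Gamma> n = H (Suc n) * ((?G (Suc n) * ?L - ?L * ?G n) * K n)"
    using L by (simp add: Y_def mat_algebra H_adjoint_Gamma K_Gamma)
  also have "?G (Suc n) * ?L - ?L * ?G n = mat_adjoint ((A - I) * \<Gamma> (Suc n) - \<Gamma> n * (A - I))"
    by (simp only: mat_adjoint_minus[of _ N N] mat_adjoint_mult[of _ N N _ N] square_mat_closed[where N = N]
       lag_A_carrier Gamma_Y_h_carrier)
  also have "\<dots> = - ?L" unfolding Gamma_A by (auto intro!: eq_matI)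
  finally show ?thesis using L by (simp add: Y_def mat_algebra)
qed

section \<open>Identities from the recurrence\<close>

context
  fixes B assumes rec: "recurrence N P H B"
begin

lemma B_carrier [simp, intro]: "B n \<in> carrier_mat N N"
  using rec by (simp add: recurrence_def)

lemma B_dim [simp]: "dim_row (B n) = N" "dim_col (B n) = N"
  using carrier_matD[OF B_carrier[of n]] by simp_all

lemma rec_0: "mat_shift (P 0) = P 1 + mat_poly_const (B 0) * P 0"
  using rec unfolding recurrence_def by (auto simp: mat_algebra dest: spec[of _ 0])

lemma rec_Suc: "mat_shift (P (Suc n)) = P (Suc (Suc n)) + mat_poly_const (B (Suc n)) * P (Suc n) + mat_poly_const (C (Suc n)) * P n"
  using rec unfolding recurrence_def C_def by (auto dest: spec[of _ "Suc n"])

text \<open>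
  Comparing the coefficients of \<open>x\<^sup>n\<close> in the recurrence.
\<close>

lemma B_eq: "B n = subleading n - subleading (Suc n)"
proof -
  have "subleading n = subleading (Suc n) + B n"
  proof (cases n)
    case 0
    have "mat_coeff (mat_shift (P 0)) 0 = mat_coeff (P 1) 0 + B 0 * mat_coeff (P 0) 0"
      unfolding rec_0 by (simp add: mat_coeff_add[of _ N N] mat_coeff_const_mult[of _ N N _ N] mat_algebra)
    thus ?thesis by (simp add: 0 subleading_def[of 0] coeff_P_Suc P_lead mat_algebra)
  next
    case (Suc m)
    have "mat_coeff (mat_shift (P n)) n = mat_coeff (P (Suc n)) n + B n * mat_coeff (P n) n + C n * mat_coeff (P m) n"
      unfolding Suc rec_Suc by (simp add: mat_coeff_add[of _ N N] mat_coeff_const_mult[of _ N N _ N] mat_algebra)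
    thus ?thesis by (simp add: subleading_def[of "Suc m"] coeff_P_Suc P_lead mat_algebra Suc P_above)
  qed
  thus ?thesis by (auto simp: mat_eq_iff)
qed

text \<open>
  Comparing the next lower coefficients in the recurrence.
\<close>

lemma C_eq: "C (Suc n) = subsubleading (Suc n) - subsubleading (Suc (Suc n)) - B (Suc n) * subleading (Suc n)"
proof -
  have "mat_coeff (mat_shift (P (Suc n))) n = subsubleading (Suc (Suc n)) + B (Suc n) * subleading (Suc n) + C (Suc n)"
    unfolding rec_Suc
    by (simp add: mat_coeff_add[of _ N N] mat_coeff_const_mult[of _ N N _ N] mat_algebra P_lead coeff_P_Suc coeff_P_Suc_Suc)
  moreover have "mat_coeff (mat_shift (P (Suc n))) n = subsubleading (Suc n)"
    by (simp add: subsubleading_def mat_coeff_shift_Suc)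
  ultimately have "subsubleading (Suc n) = subsubleading (Suc (Suc n)) + B (Suc n) * subleading (Suc n) + C (Suc n)" by simp
  thus ?thesis by (auto simp: mat_eq_iff simp del: index_mult_mat(1))
qed

text \<open>
  Eliminating \<open>B\<close>, \<open>C\<close>, \<open>Y\<close> and \<open>h\<close> in favour of the two coefficients of \<open>P\<^sub>n\<close> below the leading one
  turns the identities without \<open>\<Gamma>\<close> into formal consequences of \<open>[J, A] = A\<close>.
\<close>

lemma B_shift_relation: "B n * (A - I) - (A - I) * B (Suc n) = 2 \<cdot>\<^sub>m I + h (Suc n) - h n"
  unfolding B_eq h_eq by (simp add: mat_algebra)
    (intro eq_matI; simp add: algebra_simps del: index_mult_mat(1) index_one_mat(1))

lemma B_ladder_relation: "B (Suc n) = (B (Suc n) * J - J * B (Suc n)) + Y (Suc n) - Y (Suc (Suc n))"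
  unfolding B_eq Y_eq by (simp add: mat_algebra)
    (intro eq_matI; simp add: algebra_simps del: index_mult_mat(1) index_one_mat(1))

text \<open>
  The map \<open>X \<mapsto> 2 X + [J, X]\<close> is applied to \<open>C\<^sub>n\<close>; on the coefficients of \<open>x\<^sup>n\<^sup>-\<^sup>2\<close> in \<open>P\<^sub>n\<close> and of \<open>x\<^sup>n\<^sup>-\<^sup>1\<close> in \<open>P\<^sub>n\<^sub>+\<^sub>1\<close> its
  values are products of \<open>Y\<close> with a subleading coefficient.
\<close>

lemma C_ladder_relation:
  "2 \<cdot>\<^sub>m C (Suc n) = (C (Suc n) * J - J * C (Suc n)) - B (Suc n) * Y (Suc n) + Y (Suc n) * B n"
proof -
  have "2 \<cdot>\<^sub>m C (Suc n) = (C (Suc n) * J - J * C (Suc n))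
     + (2 \<cdot>\<^sub>m subsubleading (Suc n) + J * subsubleading (Suc n) - subsubleading (Suc n) * J)
     - (2 \<cdot>\<^sub>m subsubleading (Suc (Suc n)) + J * subsubleading (Suc (Suc n)) - subsubleading (Suc (Suc n)) * J)
     - (2 \<cdot>\<^sub>m (B (Suc n) * subleading (Suc n)) + J * (B (Suc n) * subleading (Suc n)) - B (Suc n) * subleading (Suc n) * J)"
    unfolding C_eq by (simp add: mat_algebra)
      (intro eq_matI; simp add: algebra_simps del: index_mult_mat(1) index_one_mat(1))
  also have "\<dots> = (C (Suc n) * J - J * C (Suc n)) - B (Suc n) * Y (Suc n) + Y (Suc n) * B n"
    unfolding subsubleading_eq unfolding B_eq Y_eq by (simp add: mat_algebra)
      (intro eq_matI; simp add: algebra_simps del: index_mult_mat(1) index_one_mat(1))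
  finally show ?thesis .
qed

lemma B_compatibility_relation:
  "B (Suc n) = - (J * h (Suc n) - h (Suc n) * J) - Y (Suc n) * (A - I) + (A - I) * Y (Suc (Suc n))"
  unfolding B_eq h_eq Y_eq by (simp add: mat_algebra J_A J_A_mult)
    (intro eq_matI; simp add: algebra_simps del: index_mult_mat(1) index_one_mat(1))

end

end

text \<open>
  Since \<open>weighted_form\<close> computes the integrals against \<open>W\<close>, the hypotheses are those under which the
  identities above hold. What remains is notation: \<open>A\<^sup>t - 1 = (A - 1)\<^sup>*\<close> and \<open>n = m + 1\<close>.
\<close>

theorem proposition5p9:
  fixes N :: nat and \<nu> :: real and a \<delta> :: "nat \<Rightarrow> real"
    and P :: "nat \<Rightarrow> complex poly mat" and H B :: "nat \<Rightarrow> complex mat"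
  assumes "N \<ge> 1" and "\<nu> > 0"
    and "\<And>k. k \<in> {1..N} \<Longrightarrow> \<delta> k > 0"
    and "\<And>n. monic_mat_poly N n (P n)"
    and "\<And>n m. mat_integral N
           (\<lambda>x. mat_poly_eval (P n) x * lag_W N \<nu> a \<delta> x * mat_adjoint (mat_poly_eval (P m) x))
         = (if n = m then H n else 0\<^sub>m N N)"
    and "recurrence N P H B"
  defines "A \<equiv> lag_A N a" and "J \<equiv> lag_J N" and "I \<equiv> 1\<^sub>m N :: complex mat"
  defines "C \<equiv> (\<lambda>n. H n * mat_inv (H (n - 1)))"
    and "\<Gamma> \<equiv> (\<lambda>n :: nat. A * (complex_of_real (real n + \<nu> + 1) \<cdot>\<^sub>m I + J) - of_nat n \<cdot>\<^sub>m I - J)"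
  shows
    "(\<forall>n. B n * (A - I) - (A - I) * B (n + 1)
        = 2 \<cdot>\<^sub>m I + H (n + 1) * J * mat_inv (H (n + 1)) - H n * J * mat_inv (H n)) \<and>
     (\<forall>n\<ge>1. B n
        = mat_commutator (B n) J + H n * (transpose_mat A - I) * mat_inv (H (n - 1))
          - H (n + 1) * (transpose_mat A - I) * mat_inv (H n)) \<and>
     (\<forall>n\<ge>1. 2 \<cdot>\<^sub>m (H n * mat_inv (H (n - 1)))
        = mat_commutator (H n * mat_inv (H (n - 1))) J
          - B n * H n * (transpose_mat A - I) * mat_inv (H (n - 1))
          + H n * (transpose_mat A - I) * mat_inv (H (n - 1)) * B (n - 1)) \<and>
     (\<forall>n\<ge>1. B n
        = - mat_commutator J (H n * J * mat_inv (H n))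
          - H n * (transpose_mat A - I) * mat_inv (H (n - 1)) * (A - I)
          + (A - I) * H (n + 1) * (transpose_mat A - I) * mat_inv (H n)) \<and>
     (\<forall>n\<ge>1. \<Gamma> n * C n - C n * \<Gamma> (n - 1)
        = H n * mat_adjoint (A - I) * mat_inv (H (n - 1))) \<and>
     (\<forall>n. mat_commutator (\<Gamma> n) (H n * J * mat_inv (H n))
        = of_nat n \<cdot>\<^sub>m I + \<Gamma> n + H n * J * mat_inv (H n)) \<and>
     (\<forall>n\<ge>1. \<Gamma> n * (H n * mat_adjoint (A - I) * mat_inv (H (n - 1)))
          - H n * mat_adjoint (A - I) * mat_inv (H (n - 1)) * \<Gamma> (n - 1)
        = - (H n * mat_adjoint (A - I) * mat_inv (H (n - 1))))"
proof -
  note defs = assms(7-11)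
  interpret W: laguerre_weight N \<nu> a \<delta>
    using assms(2,3) by unfold_locales auto
  interpret W: laguerre_orthogonal N \<nu> a \<delta> P H
  proof
    have P: "P n \<in> carrier_mat N N" for n by (rule monic_mat_poly_coeff(1)[OF assms(4)])
    show "W.weighted_form (P n) (P m) = (if n = m then H n else 0\<^sub>m N N)" for n m
      using assms(5)[of n m] unfolding W.mat_integral_eq_weighted_form[OF P P] .
  qed (rule assms(4))
  note rec = assms(6)
  note [simp] = W.B_carrier[OF rec]
  have tA: "transpose_mat A - I = mat_adjoint (A - I)"
    unfolding defs by (rule W.adjoint_A_minus_I[symmetric])
  have L: "mat_adjoint (A - I) \<in> carrier_mat N N"
    unfolding defs by (auto simp: W.mat_algebra)
  have AI: "A - I \<in> carrier_mat N N"
    unfolding defs by (auto simp: W.mat_algebra)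
  have Y: "H (Suc m) * mat_adjoint (A - I) * mat_inv (H m) = W.Y (Suc m)" for m
    unfolding defs W.Y_def by simp
  have BY: "B (Suc m) * H (Suc m) * mat_adjoint (A - I) * mat_inv (H m) = B (Suc m) * W.Y (Suc m)" for m
    using L by (simp add: Y[symmetric] W.mat_algebra)
  have AY: "(A - I) * H (Suc m) * mat_adjoint (A - I) * mat_inv (H m) = (A - I) * W.Y (Suc m)" for m
    using L AI by (simp only: Y[symmetric] W.mat_algebra W.H_carrier W.K_carrier)
  have C: "C (Suc m) = W.C (Suc m)" and C': "H (Suc m) * mat_inv (H m) = W.C (Suc m)" for m
    by (simp_all add: defs W.C_def)
  have h: "H m * J * mat_inv (H m) = W.h m" for m
    by (simp add: defs W.h_def)
  have G: "\<Gamma> m = W.\<Gamma> m" for m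
    by (simp add: defs W.\<Gamma>_def)
  have ex_Suc: "\<exists>m. n = Suc m" if "n \<ge> 1" for n :: nat
    using that by (cases n) auto
  show ?thesis
    unfolding tA mat_commutator_def h G
  proof (intro conjI allI impI)
    fix n
    show "B n * (A - I) - (A - I) * B (n + 1) = 2 \<cdot>\<^sub>m I + W.h (n + 1) - W.h n"
      using W.B_shift_relation[OF rec, of n] by (simp add: defs)
    show "W.\<Gamma> n * W.h n - W.h n * W.\<Gamma> n = of_nat n \<cdot>\<^sub>m I + W.\<Gamma> n + W.h n"
      using W.Gamma_h_commutator[of n] by (simp add: defs)
    assume "n \<ge> 1"
    then obtain m where n: "n = Suc m" using ex_Suc by blast
    have idx: "n - 1 = m" "n + 1 = Suc (Suc m)" using n by auto
    show "B n = B n * J - J * B n + H n * mat_adjoint (A - I) * mat_inv (H (n - 1))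
        - H (n + 1) * mat_adjoint (A - I) * mat_inv (H n)"
      unfolding idx unfolding n Y unfolding defs by (rule W.B_ladder_relation[OF rec])
    show "2 \<cdot>\<^sub>m (H n * mat_inv (H (n - 1))) =
        H n * mat_inv (H (n - 1)) * J - J * (H n * mat_inv (H (n - 1)))
        - B n * H n * mat_adjoint (A - I) * mat_inv (H (n - 1))
        + H n * mat_adjoint (A - I) * mat_inv (H (n - 1)) * B (n - 1)"
      unfolding idx unfolding n BY Y C' unfolding defs by (rule W.C_ladder_relation[OF rec])
    show "B n = - (J * W.h n - W.h n * J)
        - H n * mat_adjoint (A - I) * mat_inv (H (n - 1)) * (A - I)
        + (A - I) * H (n + 1) * mat_adjoint (A - I) * mat_inv (H n)"
      unfolding idx unfolding n AY Y unfolding defs by (rule W.B_compatibility_relation[OF rec])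
    show "W.\<Gamma> n * C n - C n * W.\<Gamma> (n - 1) = H n * mat_adjoint (A - I) * mat_inv (H (n - 1))"
      unfolding idx unfolding n Y C by (rule W.Gamma_C_relation)
    show "W.\<Gamma> n * (H n * mat_adjoint (A - I) * mat_inv (H (n - 1)))
          - H n * mat_adjoint (A - I) * mat_inv (H (n - 1)) * W.\<Gamma> (n - 1)
        = - (H n * mat_adjoint (A - I) * mat_inv (H (n - 1)))"
      unfolding idx unfolding n Y by (rule W.Gamma_Y_relation)
  qed
qed

end
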